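(* Let $q$ be a power of a prime $p$ and let $r\ge1$ be an integer satisfying one of: (1) $r=p^v-1$; (2) $(r+1)\mid(q-1)$; (3) $r+1=up^v$ for positive integers $u,v$. Let $E/\mathbb{F}_q$ be a rational function field, $\mathcal{G}\subseteq\mathrm{Aut}(E/\mathbb{F}_q)$ a subgroup of order $r+1$, $F=E^{\mathcal{G}}$ its fixed field. Let $P_\infty$ be the place at infinity of $E$, $Q_\infty$ the place of $F$ under $P_\infty$, and $z\in E$ with $(z)_\infty=P_\infty$. Let $2\le s\le\frac{q+1-2r}{r+1}$, and let $Q_1,\dots,Q_s$ be distinct rational places of $F$, different from $Q_\infty$, splitting completely in $E/F$, with $P_{i,1},\dots,P_{i,r+1}$ the places of $E$ over $Q_i$. Let $1\le t\le s$ and let $f_1,\dots,f_t$ be a basis of $\mathcal{L}((t-1)Q_\infty)$ (in $F$). For $\mathbf a=(a_{i,j})_{0\le i\le r-1,1\le j\le t}\in\mathbb{F}_q^{rt}$ let $f_{\mathbf a}=\sum_{i=0}^{r-1}\sum_{j=1}^ta_{i,j}f_jz^i$ and define $$C_e=\Big\{\Big(f_{\mathbf a}(P_{1,1}),\dots,f_{\mathbf a}(P_{s,r+1}),\ \sum_{j=1}^t a_{r-1,j}f_j(Q_1),\dots,\sum_{j=1}^ta_{r-1,j}f_j(Q_s)\Big):\mathbf a\in\mathbb{F}_q^{rt}\Big\}.$$ Then $C_e$ is an $\mathbb{F}_q$-linear $(r,3)$-LRC of length $n=s(r+2)$ and dimension $k=rt$. Moreover, if $t=s$, then $C_e$ is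 optimal, i.e. its minimum distance equals $n-k-(\lceil k/r\rceil-1)\cdot 2+1=n-rt-2t+3$.
   Context: For integers $r\ge1,\delta\ge2$, a linear code $C\subseteq\mathbb{F}_q^n$ is an $(r,\delta)$-LRC if for every coordinate $i$ there is a set $I_i\ni i$ with $|I_i|\le r+\delta-1$ such that the restriction (puncturing) of $C$ to the coordinates in $I_i$ has minimum distance at least $\delta$. An $[n,k,d]$ $(r,\delta)$-LRC satisfies $d\le n-k-(\lceil k/r\rceil-1)(\delta-1)+1$ and is called optimal if equality holds. $\mathcal{L}(G)$ denotes the Riemann–Roch space of a divisor $G$; a function $f\in F$ regular at $Q_i$ satisfies $f(P_{i,h})=f(Q_i)$. *)

theory Defs
  imports Main "HOL-Computational_Algebra.Polynomial" "HOL-Computational_Algebra.Fraction_Field"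
    "HOL-Library.Function_Algebras"
begin

type_synonym 'a ratfun = "'a poly fract"

definition const :: "'a::field \<Rightarrow> 'a ratfun" where
  "const c = Fract [:c:] 1"

definition xvar :: "'a::field ratfun" where
  "xvar = Fract [:0, 1:] 1"

definition is_aut :: "('a::field ratfun \<Rightarrow> 'a ratfun) \<Rightarrow> bool" where
  "is_aut \<sigma> \<longleftrightarrow> bij \<sigma> \<and> (\<forall>x y. \<sigma> (x + y) = \<sigma> x + \<sigma> y) \<and> (\<forall>x y. \<sigma> (x * y) = \<sigma> x * \<sigma> y)
     \<and> (\<forall>c. \<sigma> (const c) = const c)"

definition aut_subgroup :: "('a::field ratfun \<Rightarrow> 'a ratfun) set \<Rightarrow> bool" where
  "aut_subgroup G \<longleftrightarrow> (\<forall>\<sigma>\<in>G. is_aut \<sigma>) \<and> id \<in> G \<and> (\<forall>\<sigma>\<in>G. \<forall>\<tau>\<in>G. \<sigma> \<circ> \<tau> \<in> G)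
     \<and> (\<forall>\<sigma>\<in>G. inv \<sigma> \<in> G)"

definition fixed_field :: "('a::field ratfun \<Rightarrow> 'a ratfun) set \<Rightarrow> 'a ratfun set" where
  "fixed_field G = {f. \<forall>\<sigma>\<in>G. \<sigma> f = f}"

text \<open>A place of a function field K \<subseteq> E (over F_q) is represented by its valuation ring V.\<close>
definition is_place :: "'a::field ratfun set \<Rightarrow> 'a ratfun set \<Rightarrow> bool" where
  "is_place K V \<longleftrightarrow> V \<subseteq> K \<and> (\<forall>c. const c \<in> V) \<and>
     (\<forall>x\<in>V. \<forall>y\<in>V. x + y \<in> V \<and> x * y \<in> V \<and> - x \<in> V) \<and> V \<noteq> K \<and>
     (\<forall>x\<in>K. x \<noteq> 0 \<longrightarrow> x \<in> V \<or> inverse x \<in> V)"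

definition maxideal :: "'a::field ratfun set \<Rightarrow> 'a ratfun set" where
  "maxideal V = {x\<in>V. x = 0 \<or> inverse x \<notin> V}"

definition rational_place :: "'a::field ratfun set \<Rightarrow> 'a ratfun set \<Rightarrow> bool" where
  "rational_place K V \<longleftrightarrow> is_place K V \<and> (\<forall>f\<in>V. \<exists>c. f - const c \<in> maxideal V)"

definition eval_at :: "'a::field ratfun set \<Rightarrow> 'a ratfun \<Rightarrow> 'a" where
  "eval_at V f = (THE c. f - const c \<in> maxideal V)"

definition lies_over :: "'a::field ratfun set \<Rightarrow> 'a ratfun set \<Rightarrow> bool" where
  "lies_over V' V \<longleftrightarrow> maxideal V \<subseteq> maxideal V'"

definition uniformizer :: "'a::field ratfun set \<Rightarrow> 'a ratfun \<Rightarrow> bool" where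
  "uniformizer V t \<longleftrightarrow> t \<in> V \<and> maxideal V = {t * u | u. u \<in> V}"

definition Pinf :: "'a::field ratfun set" where
  "Pinf = {Fract a b | a b. b \<noteq> 0 \<and> degree a \<le> degree b}"

definition RR_space :: "'a::field ratfun set \<Rightarrow> 'a ratfun set \<Rightarrow> nat \<Rightarrow> 'a ratfun set" where
  "RR_space K Q m = {f\<in>K. (\<forall>Q'. is_place K Q' \<and> Q' \<noteq> Q \<longrightarrow> f \<in> Q') \<and>
       (\<exists>t. uniformizer Q t \<and> t ^ m * f \<in> Q)}"

definition pole_divisor_is :: "'a::field ratfun set \<Rightarrow> 'a ratfun set \<Rightarrow> 'a ratfun \<Rightarrow> bool" where
  "pole_divisor_is K V z \<longleftrightarrow> z \<in> K \<and> (\<forall>V'. is_place K V' \<and> V' \<noteq> V \<longrightarrow> z \<in> V') \<and>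
       (\<exists>t. uniformizer V t \<and> t * z \<in> V - maxideal V)"

text \<open>Codes: words of length n are functions nat => 'a vanishing from n on.\<close>
definition fscale :: "'a::field \<Rightarrow> (nat \<Rightarrow> 'a) \<Rightarrow> (nat \<Rightarrow> 'a)" where
  "fscale c v = (\<lambda>i. c * v i)"

definition linear_code :: "nat \<Rightarrow> (nat \<Rightarrow> 'a::field) set \<Rightarrow> bool" where
  "linear_code n C \<longleftrightarrow> (\<forall>c\<in>C. \<forall>i\<ge>n. c i = 0) \<and> module.subspace fscale C"

definition code_dim :: "(nat \<Rightarrow> 'a::field) set \<Rightarrow> nat" where
  "code_dim C = vector_space.dim fscale C"

definition weight :: "(nat \<Rightarrow> 'a::zero) \<Rightarrow> nat" where
  "weight c = card {j. c j \<noteq> 0}"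

definition min_dist :: "(nat \<Rightarrow> 'a::zero) set \<Rightarrow> nat" where
  "min_dist C = Min {weight c | c. c \<in> C \<and> c \<noteq> 0}"

text \<open>Puncturing C to I has minimum distance at least \<delta> (zero code counts as satisfying).\<close>
definition punct_dist_ge :: "(nat \<Rightarrow> 'a::zero) set \<Rightarrow> nat set \<Rightarrow> nat \<Rightarrow> bool" where
  "punct_dist_ge C I \<delta> \<longleftrightarrow> (\<forall>c\<in>C. (\<exists>j\<in>I. c j \<noteq> 0) \<longrightarrow> card {j\<in>I. c j \<noteq> 0} \<ge> \<delta>)"

definition is_LRC :: "nat \<Rightarrow> nat \<Rightarrow> nat \<Rightarrow> (nat \<Rightarrow> 'a::field) set \<Rightarrow> bool" where
  "is_LRC n r \<delta> C \<longleftrightarrow> linear_code n C \<and>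
     (\<forall>i<n. \<exists>I. i \<in> I \<and> I \<subseteq> {..<n} \<and> card I \<le> r + \<delta> - 1 \<and> punct_dist_ge C I \<delta>)"

definition optimal_LRC :: "nat \<Rightarrow> nat \<Rightarrow> nat \<Rightarrow> (nat \<Rightarrow> 'a::field) set \<Rightarrow> bool" where
  "optimal_LRC n r \<delta> C \<longleftrightarrow> is_LRC n r \<delta> C \<and>
     int (min_dist C) = int n - int (code_dim C)
        - (\<lceil>real (code_dim C) / real r\<rceil> - 1) * (int \<delta> - 1) + 1"

end

theory Submission
  imports Defs "HOL-Computational_Algebra.Polynomial_Factorial" "HOL-Library.FuncSet"
begin

text \<open>Along the coordinates belonging to \<open>Q\<^sub>i\<close> a codeword lists the values, at the \<open>r + 1\<close> distinct points
  \<open>z(P\<^sub>i\<^sub>h)\<close>, of a polynomial in \<open>z\<close> of degree less than \<open>r\<close> with constant coefficients, followed by its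
  coefficient of \<open>z\<close> to the power \<open>r - 1\<close>. This doubly extended Reed--Solomon block of length \<open>r + 2\<close>
  has distance 3, which gives locality and bounds the minimum distance from below. A zero codeword
  makes every coefficient function vanish at all \<open>Q\<^sub>i\<close>. Such a function \<open>g \<in> L((t - 1) Q\<^sub>\<infinity>)\<close> is zero: with
  \<open>w \<in> F\<close> of degree at most \<open>r + 1\<close> having a pole at \<open>Q\<^sub>\<infinity>\<close>, the quotient of \<open>g\<close> by the power \<open>t - 1\<close>
  of \<open>w\<close> is regular at \<open>Q\<^sub>\<infinity>\<close>, so \<open>g\<close> has at most \<open>(t - 1)(r + 1)\<close> zeros in \<open>E\<close>, fewer than the
  \<open>s(r + 1)\<close> places above the \<open>Q\<^sub>i\<close>. For \<open>t = s\<close> the coefficient functions interpolate arbitrary values at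
  the \<open>Q\<^sub>i\<close>, and a word of weight 3 arises from a polynomial with \<open>r - 1\<close> roots in a single block.\<close>

section \<open>Places of the rational function field\<close>

lemma const_to_fract: "const c = to_fract [:c:]"
  by (simp add: const_def to_fract_def)

lemma xvar_to_fract: "xvar = to_fract [:0, 1:]"
  by (simp add: xvar_def to_fract_def)

lemma const_0 [simp]: "const 0 = 0"
  by (simp add: const_to_fract)

lemma const_1 [simp]: "const 1 = 1"
  by (simp add: const_to_fract one_pCons[symmetric])

lemma const_eq_0_iff [simp]: "const c = 0 \<longleftrightarrow> c = 0"
  by (simp add: const_to_fract)

lemma const_add: "const (a + b) = const a + const b"
  by (simp add: const_to_fract flip: to_fract_add)

lemma const_diff: "const (a - b) = const a - const b"
  by (simp add: const_to_fract flip: to_fract_diff)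

lemma const_mult: "const (a * b) = const a * const b"
  by (simp add: const_to_fract flip: to_fract_mult)

lemma const_uminus: "const (- a) = - const a"
  by (simp add: const_to_fract flip: to_fract_uminus)

lemma const_sum: "const (sum f A) = (\<Sum>i\<in>A. const (f i))"
  by (induction A rule: infinite_finite_induct) (auto simp: const_add)

lemma to_fract_power: "to_fract (a ^ n) = to_fract a ^ n"
  by (induction n) auto

lemma to_fract_pCons: "to_fract (pCons c a) = const c + xvar * to_fract a"
proof -
  have "pCons c a = [:c:] + [:0, 1:] * a" by simp
  then show ?thesis by (simp only: const_to_fract xvar_to_fract flip: to_fract_mult to_fract_add)
qed

lemma ratfun_cases:
  obtains a b where "f = to_fract a / to_fract b" "b \<noteq> 0"
  by (metis Fract_cases_nonzero Fract_conv_to_fract to_fract_0 to_fract_1 div_0 zero_neq_one)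

section \<open>Arithmetic in a valuation ring and its maximal ideal\<close>

context
  fixes K V :: "'a::field ratfun set"
  assumes V: "is_place K V"
begin

lemma place_subset: "f \<in> V \<Longrightarrow> f \<in> K"
  using V by (auto simp: is_place_def)

lemma place_const: "const c \<in> V"
  using V by (simp add: is_place_def)

lemma place_0: "0 \<in> V"
  using place_const[of 0] by simp

lemma place_1: "1 \<in> V"
  using place_const[of 1] by simp

lemma place_add: "f \<in> V \<Longrightarrow> g \<in> V \<Longrightarrow> f + g \<in> V"
  using V by (simp add: is_place_def)

lemma place_mult: "f \<in> V \<Longrightarrow> g \<in> V \<Longrightarrow> f * g \<in> V"
  using V by (simp add: is_place_def)

lemma place_uminus: "f \<in> V \<Longrightarrow> - f \<in> V"
  using V unfolding is_place_def by blast

lemma place_power: "f \<in> V \<Longrightarrow> f ^ n \<in> V"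
  by (induction n) (auto intro: place_1 place_mult)

lemma place_sum: "(\<And>i. i \<in> A \<Longrightarrow> f i \<in> V) \<Longrightarrow> sum f A \<in> V"
  by (induction A rule: infinite_finite_induct) (auto intro: place_0 place_add)

lemma place_inverse: "f \<in> K \<Longrightarrow> f \<notin> V \<Longrightarrow> inverse f \<in> maxideal V"
  using V place_0 by (auto simp: is_place_def maxideal_def)

lemma maxideal_subset: "f \<in> maxideal V \<Longrightarrow> f \<in> V"
  by (simp add: maxideal_def)

lemma maxideal_0: "0 \<in> maxideal V"
  using place_0 by (simp add: maxideal_def)

text \<open>If \<open>inverse (f * g)\<close> were in \<open>V\<close> with \<open>f * g\<close>
  nonzero, multiplying it by \<open>f\<close> would put \<open>inverse g\<close> there as
  well.\<close>

lemma maxideal_mult_left: "f \<in> V \<Longrightarrow> g \<in> maxideal V \<Longrightarrow> f * g \<in> maxideal V"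
  using place_mult[of f "inverse (f * g)"] place_mult[of f g]
  by (auto simp: maxideal_def field_simps)

lemma maxideal_mult_right: "f \<in> maxideal V \<Longrightarrow> g \<in> V \<Longrightarrow> f * g \<in> maxideal V"
  using maxideal_mult_left[of g f] by (simp add: mult.commute)

lemma maxideal_prime: "f \<in> V \<Longrightarrow> g \<in> V \<Longrightarrow> f * g \<in> maxideal V \<Longrightarrow> f \<in> maxideal V \<or> g \<in> maxideal V"
  using place_mult[of "inverse f" "inverse g"] by (auto simp: maxideal_def)

lemma maxideal_power: "f \<in> V \<Longrightarrow> f ^ n \<in> maxideal V \<Longrightarrow> f \<in> maxideal V"
proof (induction n)
  case 0
  then show ?case using place_1 by (simp add: maxideal_def)
next
  case (Suc n)
  then show ?case using maxideal_prime[of f "f ^ n"] place_power by auto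
qed

lemma const_maxideal_iff: "const c \<in> maxideal V \<longleftrightarrow> c = 0"
proof (cases "c = 0")
  case False
  have "const c * const (inverse c) = 1"
    using False by (simp flip: const_mult)
  then have "inverse (const c) = const (inverse c)"
    by (metis inverse_unique)
  then show ?thesis using False place_const by (simp add: maxideal_def)
qed (simp add: maxideal_0)

lemma one_notin_maxideal: "1 \<notin> maxideal V"
  using const_maxideal_iff[of 1] by simp

end

section \<open>Maximal ideals and residue values for places of the full field\<close>

context
  fixes V :: "'a::field ratfun set"
  assumes V: "is_place UNIV V"
begin

text \<open>For nonzero \<open>f\<close> and \<open>g\<close>, one of \<open>f / g\<close> and
  \<open>g / f\<close> lies in \<open>V\<close>, so the sum is an element of \<open>V\<close> times
  \<open>g\<close> or \<open>f\<close>. The induction on a truth value is a plain case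
  split.\<close>

lemma maxideal_add: "f \<in> maxideal V \<Longrightarrow> g \<in> maxideal V \<Longrightarrow> f + g \<in> maxideal V"
proof (induction "f / g \<in> V" arbitrary: f g)
  case True
  show ?case
  proof (cases "g = 0")
    case False
    then have "f + g = (f / g + 1) * g" by (simp add: field_simps)
    then show ?thesis
      using maxideal_mult_left[OF V] place_add[OF V _ place_1[OF V]] True by metis
  qed (use True in simp)
next
  case False
  show ?case
  proof (cases "f = 0")
    case fn: False
    have "inverse (f / g) \<in> V"
      using place_inverse[OF V _ False.hyps[symmetric, simplified]] maxideal_subset[OF V] False by simp
    moreover have "f + g = (inverse (f / g) + 1) * f"
      using fn by (simp add: field_simps)
    ultimately show ?thesis
      using maxideal_mult_left[OF V] place_add[OF V _ place_1[OF V]] False by metis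
  qed (use False in simp)
qed

lemma maxideal_uminus: "f \<in> maxideal V \<Longrightarrow> - f \<in> maxideal V"
  using maxideal_mult_left[OF V, of "- 1" f] place_uminus[OF V place_1[OF V]] by simp

lemma maxideal_diff: "f \<in> maxideal V \<Longrightarrow> g \<in> maxideal V \<Longrightarrow> f - g \<in> maxideal V"
  using maxideal_add[of f "- g"] maxideal_uminus[of g] by simp

lemma maxideal_sum: "(\<And>i. i \<in> A \<Longrightarrow> f i \<in> maxideal V) \<Longrightarrow> sum f A \<in> maxideal V"
  by (induction A rule: infinite_finite_induct) (auto intro: maxideal_0[OF V] maxideal_add)

lemma eval_at_eqI:
  assumes "f - const c \<in> maxideal V"
  shows "eval_at V f = c"
  unfolding eval_at_def
proof (rule the_equality)
  fix d assume "f - const d \<in> maxideal V"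
  from maxideal_diff[OF this assms] have "const (c - d) \<in> maxideal V"
    by (simp add: const_diff)
  then show "d = c" by (simp add: const_maxideal_iff[OF V])
qed (rule assms)

lemma value_mult:
  assumes "f - const c \<in> maxideal V" "g - const d \<in> maxideal V" "f \<in> V"
  shows "f * g - const (c * d) \<in> maxideal V"
proof -
  have "f * g - const (c * d) = f * (g - const d) + (f - const c) * const d"
    by (simp add: const_mult algebra_simps)
  then show ?thesis
    using maxideal_add maxideal_mult_left[OF V] maxideal_mult_right[OF V] place_const[OF V] assms
    by metis
qed

lemma value_in_place:
  assumes "f - const c \<in> maxideal V"
  shows "f \<in> V"
proof -
  have "(f - const c) + const c \<in> V"
    using assms place_add[OF V maxideal_subset[OF V] place_const[OF V]] by blast
  then show ?thesis by simp
qed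

lemma value_power:
  assumes "f - const c \<in> maxideal V"
  shows "f ^ n - const (c ^ n) \<in> maxideal V"
proof (induction n)
  case (Suc n)
  show ?case using value_mult[OF assms Suc value_in_place[OF assms]] by simp
qed (simp add: maxideal_0[OF V])

lemma value_sum:
  assumes "\<And>i. i \<in> A \<Longrightarrow> f i - const (c i) \<in> maxideal V"
  shows "sum f A - const (sum c A) \<in> maxideal V"
  using maxideal_sum[of A "\<lambda>i. f i - const (c i)", OF assms]
  by (simp add: const_sum sum_subtractf)

lemma value_const: "const c - const c \<in> maxideal V"
  using maxideal_0[OF V] by simp

end

lemma place_to_fract:
  assumes V: "is_place UNIV V" and x: "xvar \<in> V"
  shows "to_fract a \<in> V"
proof (induction a)
  case (pCons c a)
  then show ?case
    using place_add[OF V place_const[OF V] place_mult[OF V x]] by (simp add: to_fract_pCons)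
qed (simp add: place_0[OF V])

section \<open>The place at infinity\<close>

lemma Pinf_iff:
  assumes "b \<noteq> 0"
  shows "to_fract a / to_fract b \<in> Pinf \<longleftrightarrow> degree a \<le> degree b"
proof
  assume "to_fract a / to_fract b \<in> Pinf"
  then obtain a' b' where e: "Fract a b = Fract a' b'" "b' \<noteq> 0" "degree a' \<le> degree b'"
    by (auto simp: Pinf_def Fract_conv_to_fract)
  \<comment> \<open>Cross-multiplication shows that the difference of the degrees does not depend on
    the chosen fraction.\<close>
  then have *: "a * b' = a' * b" using assms by (simp add: eq_fract)
  show "degree a \<le> degree b"
  proof (cases "a = 0")
    case False
    then have "a' \<noteq> 0" using * e assms by auto
    then show ?thesis
      using arg_cong[OF *, of degree] e assms False by (simp add: degree_mult_eq)
  qed simp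
qed (use assms in \<open>auto simp: Pinf_def Fract_conv_to_fract\<close>)

lemma is_place_Pinf: "is_place UNIV (Pinf :: 'a::field ratfun set)"
  unfolding is_place_def
proof (intro conjI ballI allI impI)
  show "const c \<in> Pinf" for c :: 'a
    using Pinf_iff[of 1 "[:c:]"] by (simp add: const_to_fract)
  fix f :: "'a ratfun"
  obtain a b where f: "f = to_fract a / to_fract b" "b \<noteq> 0" by (rule ratfun_cases)
  show "f \<noteq> 0 \<Longrightarrow> f \<in> Pinf \<or> inverse f \<in> Pinf"
    using f Pinf_iff[of b a] Pinf_iff[of a b] by auto
  have "- f = to_fract (- a) / to_fract b" using f by simp
  then show "- f \<in> Pinf" if "f \<in> Pinf"
    using that f Pinf_iff[of b a] Pinf_iff[of b "- a"] by (metis degree_minus)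
  fix g :: "'a ratfun"
  obtain c d where g: "g = to_fract c / to_fract d" "d \<noteq> 0" by (rule ratfun_cases)
  assume "f \<in> Pinf" "g \<in> Pinf"
  then have le: "degree a \<le> degree b" "degree c \<le> degree d"
    using f g Pinf_iff by auto
  have "f + g = to_fract (a * d + c * b) / to_fract (b * d)"
    using f g by (simp add: field_simps)
  moreover have "degree (a * d + c * b) \<le> degree (b * d)"
    using le f g degree_mult_le[of a d] degree_mult_le[of c b]
    by (intro degree_add_le) (simp_all add: degree_mult_eq)
  ultimately show "f + g \<in> Pinf"
    using Pinf_iff[of "b * d" "a * d + c * b"] f g by (simp only: mult_eq_0_iff simp_thms)
  have "f * g = to_fract (a * c) / to_fract (b * d)"
    using f g by (simp add: field_simps)
  moreover have "degree (a * c) \<le> degree (b * d)"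
    using le f g degree_mult_le[of a c] by (simp add: degree_mult_eq)
  ultimately show "f * g \<in> Pinf"
    using Pinf_iff[of "b * d" "a * c"] f g by (simp only: mult_eq_0_iff simp_thms)
next
  have "xvar \<notin> (Pinf :: 'a ratfun set)"
    using Pinf_iff[of 1 "[:0,1:]"] by (simp add: xvar_to_fract)
  then show "Pinf \<noteq> (UNIV :: 'a ratfun set)" by blast
qed auto

lemma xvar_notin_Pinf: "xvar \<notin> Pinf"
  using Pinf_iff[of 1 "[:0,1:]"] by (simp add: xvar_to_fract)

text \<open>An element of the maximal ideal has order at least one at infinity, which absorbs the
  simple pole of \<open>xvar\<close>.\<close>

lemma maxideal_Pinf_mult_xvar:
  assumes "f \<in> maxideal Pinf"
  shows "f * xvar \<in> Pinf"
proof -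
  obtain a b where f: "f = to_fract a / to_fract b" "b \<noteq> 0" by (rule ratfun_cases)
  show ?thesis
  proof (cases "f = 0")
    case False
    then have "a \<noteq> 0" using f by auto
    then have "\<not> degree b \<le> degree a"
      using assms False Pinf_iff[of a b] f by (simp add: maxideal_def)
    moreover have "f * xvar = to_fract (a * [:0,1:]) / to_fract b"
      by (simp only: f xvar_to_fract to_fract_mult times_divide_eq_left)
    ultimately show ?thesis using f \<open>a \<noteq> 0\<close>
      using Pinf_iff[of b "pCons 0 a"] by simp
  qed (simp add: place_0[OF is_place_Pinf])
qed

text \<open>With \<open>y = 1 / x\<close> in the maximal ideal, a polynomial times a large enough
  power of \<open>y\<close> is a polynomial in \<open>y\<close>. A fraction in \<open>Pinf\<close>
  thus becomes an element of \<open>V\<close> divided by a unit of \<open>V\<close>, so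
  \<open>Pinf\<close> is contained in \<open>V\<close>.\<close>

lemma place_eq_Pinf:
  assumes V: "is_place UNIV V" and x: "xvar \<notin> V"
  shows "V = Pinf"
proof -
  define y where "y = inverse (xvar :: 'a ratfun)"
  have x0: "xvar \<noteq> (0 :: 'a ratfun)" by (simp add: xvar_to_fract)
  have y: "y \<in> maxideal V" unfolding y_def by (rule place_inverse[OF V _ x]) simp
  have yV: "y \<in> V" by (rule maxideal_subset[OF V y])
  have le: "to_fract a * y ^ n \<in> V" if "degree a \<le> n" for a n
    using that
  proof (induction n arbitrary: a)
    case 0
    then obtain c where "a = [:c:]" using degree_eq_zeroE by blast
    then show ?case using place_const[OF V] by (simp add: const_to_fract)
  next
    case (Suc n)
    obtain c b where a: "a = pCons c b" by (cases a)
    have "degree b \<le> n" using Suc.prems a by (cases "b = 0") auto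
    then have "to_fract b * y ^ n \<in> V" by (rule Suc.IH)
    moreover have "to_fract a * y ^ Suc n = const c * y ^ Suc n + to_fract b * y ^ n"
      using x0 by (simp add: a to_fract_pCons y_def field_simps)
    ultimately show ?case
      using place_add[OF V] place_mult[OF V] place_const[OF V] place_power[OF V yV] by metis
  qed
  \<comment> \<open>After scaling, the residue is the leading coefficient, because the lower terms
    keep a factor \<open>y\<close>.\<close>
  have unit: "to_fract b * y ^ degree b \<in> V - maxideal V" if "b \<noteq> 0" for b
  proof -
    define n where "n = degree b"
    define b' where "b' = b - monom (lead_coeff b) n"
    have e: "to_fract b * y ^ n = const (lead_coeff b) + to_fract b' * y ^ n"
    proof -
      have "to_fract (monom (lead_coeff b) n) = const (lead_coeff b) * xvar ^ n"
        by (simp add: const_to_fract xvar_to_fract monom_altdef flip: to_fract_mult to_fract_power)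
      then show ?thesis using x0 by (simp add: b'_def y_def field_simps)
    qed
    have "to_fract b' * y ^ n \<in> maxideal V"
    proof (cases n)
      case 0
      then obtain c where "b = [:c:]" using degree_eq_zeroE[of b] n_def by metis
      then have "b' = 0" using 0 by (simp add: b'_def monom_0)
      then show ?thesis by (simp add: maxideal_0[OF V])
    next
      case (Suc m)
      have "degree b' \<le> m"
      proof (rule degree_le, intro allI impI)
        fix i assume "m < i"
        then show "coeff b' i = 0"
          using Suc coeff_eq_0[of b i] by (cases "i = n") (auto simp: b'_def n_def)
      qed
      then have "y * (to_fract b' * y ^ m) \<in> maxideal V"
        using maxideal_mult_right[OF V y le] by blast
      then show ?thesis by (simp add: Suc algebra_simps)
    qed
    moreover have "const (lead_coeff b) \<notin> maxideal V"
      using that by (simp add: const_maxideal_iff[OF V])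
    ultimately have "to_fract b * y ^ n \<notin> maxideal V"
      using maxideal_diff[OF V, of "to_fract b * y ^ n" "to_fract b' * y ^ n"] e by force
    then show ?thesis using le[of b n] by (simp add: n_def)
  qed
  have sub: "f \<in> V" if "f \<in> Pinf" for f
  proof -
    obtain a b where f: "f = to_fract a / to_fract b" "b \<noteq> 0" by (rule ratfun_cases)
    then have d: "degree a \<le> degree b" using that Pinf_iff by auto
    have "inverse (to_fract b * y ^ degree b) \<in> V"
      using unit[OF f(2)] by (simp add: maxideal_def)
    with le[OF d] have "to_fract a * y ^ degree b * inverse (to_fract b * y ^ degree b) \<in> V"
      by (rule place_mult[OF V])
    moreover have "to_fract a * u * inverse (to_fract b * u) = f" if "u \<noteq> 0" for u
      using that f by (simp add: divide_inverse)
    ultimately show ?thesis using x0 by (simp add: y_def)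
  qed
  moreover have "f \<in> Pinf" if "f \<in> V" for f
  proof (rule ccontr)
    \<comment> \<open>\<open>1 / f\<close> vanishes at infinity, so \<open>x / f\<close> is still in
      \<open>Pinf\<close> and hence in \<open>V\<close>; multiplying by \<open>f\<close> would put
      \<open>x\<close> into \<open>V\<close>.\<close>
    assume nf: "f \<notin> Pinf"
    then have "inverse f * xvar \<in> V"
      using maxideal_Pinf_mult_xvar place_inverse[OF is_place_Pinf _ nf] sub by blast
    then have "f * (inverse f * xvar) \<in> V" using that place_mult[OF V] by blast
    moreover have "f \<noteq> 0" using nf place_0[OF is_place_Pinf] by auto
    ultimately show False using x by (simp flip: mult.assoc)
  qed
  ultimately show ?thesis by blast
qed

lemma place_xvar_iff: "is_place UNIV V \<Longrightarrow> xvar \<in> V \<longleftrightarrow> V \<noteq> Pinf"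
  using place_eq_Pinf xvar_notin_Pinf by blast

section \<open>Finite places and their prime polynomials\<close>

definition place_poly :: "'a::field ratfun set \<Rightarrow> 'a poly \<Rightarrow> bool" where
  "place_poly V p \<longleftrightarrow> p \<noteq> 0 \<and> (\<forall>a. to_fract a \<in> maxideal V \<longleftrightarrow> p dvd a)"

text \<open>The polynomials in the maximal ideal form an ideal, generated by any nonzero member of
  least degree. A nonzero member exists: for \<open>f = a / b\<close> outside \<open>V\<close>, it
  is \<open>b = a * inverse f\<close>.\<close>

lemma place_poly_exists:
  assumes V: "is_place UNIV V" and x: "xvar \<in> V"
  shows "\<exists>p. place_poly V p"
proof -
  have pV: "to_fract a \<in> V" for a by (rule place_to_fract[OF V x])
  have "V \<noteq> UNIV" using V by (simp add: is_place_def)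
  then obtain f where nf: "f \<notin> V" by blast
  obtain a b where f: "f = to_fract a / to_fract b" "b \<noteq> 0" by (rule ratfun_cases)
  have "a \<noteq> 0" using nf f place_0[OF V] by auto
  have "to_fract a * inverse f \<in> maxideal V"
    by (rule maxideal_mult_left[OF V pV place_inverse[OF V _ nf]]) simp
  then have "b \<noteq> 0 \<and> to_fract b \<in> maxideal V" using f \<open>a \<noteq> 0\<close> by simp
  from arg_min_nat_lemma[of "\<lambda>b. b \<noteq> 0 \<and> to_fract b \<in> maxideal V" b degree, OF this]
  obtain p where p: "p \<noteq> 0" "to_fract p \<in> maxideal V"
    and least: "\<And>b. b \<noteq> 0 \<Longrightarrow> to_fract b \<in> maxideal V \<Longrightarrow> degree p \<le> degree b" by blast
  have "p dvd a" if "to_fract a \<in> maxideal V" for a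
  proof -
    have "to_fract (a mod p) = to_fract a - to_fract (a div p) * to_fract p"
      by (simp add: minus_div_mult_eq_mod flip: to_fract_mult to_fract_diff)
    then have "to_fract (a mod p) \<in> maxideal V"
      using maxideal_diff[OF V that maxideal_mult_left[OF V pV p(2)]] by simp
    then have "a mod p = 0"
      using least[of "a mod p"] degree_mod_less[OF p(1), of a] by fastforce
    then show ?thesis by (simp add: mod_eq_0_iff_dvd)
  qed
  moreover have "to_fract a \<in> maxideal V" if "p dvd a" for a
    using that maxideal_mult_right[OF V p(2) pV] by (auto elim!: dvdE)
  ultimately show ?thesis using p unfolding place_poly_def by blast
qed

context
  fixes V :: "'a::field ratfun set" and p :: "'a poly"
  assumes V: "is_place UNIV V" and x: "xvar \<in> V" and p: "place_poly V p"
begin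

lemma place_poly_prime: "prime_elem p"
proof -
  have "\<not> p dvd 1"
    using p one_notin_maxideal[OF V] unfolding place_poly_def by (metis to_fract_1)
  moreover have "p dvd a \<or> p dvd b" if "p dvd a * b" for a b
    using that p maxideal_prime[OF V place_to_fract[OF V x] place_to_fract[OF V x], of a b]
    unfolding place_poly_def by (metis to_fract_mult)
  ultimately show ?thesis using p by (simp add: prime_elem_def place_poly_def)
qed

lemma place_poly_degree: "degree p \<ge> 1"
proof (rule ccontr)
  assume "\<not> degree p \<ge> 1"
  moreover have "p \<noteq> 0" using p by (simp add: place_poly_def)
  ultimately have "is_unit p" by (simp add: is_unit_iff_degree)
  then show False using place_poly_prime by (simp add: prime_elem_def)
qed

lemma maxideal_place_poly: "to_fract a \<in> maxideal V \<longleftrightarrow> p dvd a"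
  using p by (simp add: place_poly_def)

text \<open>Identifies \<open>V\<close> with the localization at \<open>p\<close>. In a fraction
  whose denominator \<open>b\<close> has least degree, \<open>p\<close> cannot divide
  \<open>b\<close>: then \<open>a = f * b\<close> would vanish at \<open>V\<close> too, and
  cancelling \<open>p\<close> would contradict minimality.\<close>

lemma place_poly_place: "f \<in> V \<longleftrightarrow> (\<exists>a b. f = to_fract a / to_fract b \<and> \<not> p dvd b)"
proof
  assume f: "f \<in> V"
  obtain a0 b0 where f0: "f = to_fract a0 / to_fract b0" "b0 \<noteq> 0" by (rule ratfun_cases)
  then have "\<exists>a b. b \<noteq> 0 \<and> f = to_fract a / to_fract b" by blast
  then obtain b1 where "\<exists>a. b1 \<noteq> 0 \<and> f = to_fract a / to_fract b1" by blast
  from arg_min_nat_lemma[of "\<lambda>b. \<exists>a. b \<noteq> 0 \<and> f = to_fract a / to_fract b" b1 degree, OF this]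
  obtain a b where ab: "b \<noteq> 0" "f = to_fract a / to_fract b"
    and least: "\<And>a' b'. b' \<noteq> 0 \<Longrightarrow> f = to_fract a' / to_fract b' \<Longrightarrow> degree b \<le> degree b'" by blast
  have "\<not> p dvd b"
  proof
    assume "p dvd b"
    then have "f * to_fract b \<in> maxideal V"
      using maxideal_mult_left[OF V f] maxideal_place_poly by blast
    then have "p dvd a" using ab maxideal_place_poly by simp
    then obtain a' b' where e: "a = p * a'" "b = p * b'"
      using \<open>p dvd b\<close> by (auto elim!: dvdE)
    have "p \<noteq> 0" using p by (simp add: place_poly_def)
    then have "f = to_fract a' / to_fract b'" "b' \<noteq> 0" using ab e by auto
    moreover have "degree b = degree p + degree b'"
      using e \<open>p \<noteq> 0\<close> calculation by (simp add: degree_mult_eq)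
    ultimately show False using least[of b' a'] place_poly_degree by simp
  qed
  then show "\<exists>a b. f = to_fract a / to_fract b \<and> \<not> p dvd b" using ab by blast
next
  assume "\<exists>a b. f = to_fract a / to_fract b \<and> \<not> p dvd b"
  then obtain a b where f: "f = to_fract a / to_fract b" "\<not> p dvd b" by blast
  then have "inverse (to_fract b) \<in> V"
    using place_to_fract[OF V x, of b] maxideal_place_poly[of b] by (auto simp: maxideal_def)
  then show "f \<in> V" using place_mult[OF V place_to_fract[OF V x, of a]] f
    by (simp add: divide_inverse)
qed

end

text \<open>Between primes divisibility is association, so both localizations admit the same
  denominators.\<close>

lemma place_poly_unique:
  assumes "is_place UNIV V" "xvar \<in> V" "place_poly V p"
    and "is_place UNIV W" "xvar \<in> W" "place_poly W q" and "p dvd q"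
  shows "V = W"
proof -
  have "irreducible q" "prime_elem p"
    using place_poly_prime assms prime_elem_imp_irreducible by blast+
  then have "q dvd p"
    using \<open>p dvd q\<close> by (metis irreducibleD' prime_elem_not_unit)
  then have "p dvd b \<longleftrightarrow> q dvd b" for b using \<open>p dvd q\<close> dvd_trans by blast
  then show ?thesis
    using place_poly_place[OF assms(1-3)] place_poly_place[OF assms(4-6)] by blast
qed

lemma prime_elem_dvd_prod:
  assumes "prime_elem p" and "p dvd (\<Prod>i\<in>S. f i)"
  shows "\<exists>i\<in>S. p dvd f i"
  using assms(2)
proof (induction S rule: infinite_finite_induct)
  case (insert i S)
  then have "p dvd f i \<or> p dvd (\<Prod>i\<in>S. f i)"
    by (simp only: prod.insert prime_elem_dvd_mult_iff[OF assms(1)] simp_thms)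
  then show ?case using insert.IH by blast
qed (use assms(1) in \<open>auto simp: prime_elem_def\<close>)

text \<open>Distinct places have non-associated primes, so a further prime dividing \<open>a\<close>
  must divide the cofactor left by the earlier ones.\<close>

lemma prod_place_poly_dvd:
  assumes "finite S" and "\<And>V. V \<in> S \<Longrightarrow> is_place UNIV V \<and> xvar \<in> V \<and> place_poly V (p V)"
    and "\<And>V. V \<in> S \<Longrightarrow> to_fract a \<in> maxideal V"
  shows "(\<Prod>V\<in>S. p V) dvd a"
  using assms
proof (induction S)
  case (insert W S)
  then have "(\<Prod>V\<in>S. p V) dvd a" by blast
  then obtain k where k: "a = (\<Prod>V\<in>S. p V) * k" by (auto elim: dvdE)
  have pr: "prime_elem (p W)" using place_poly_prime insert.prems by blast
  have W: "is_place UNIV W" "xvar \<in> W" "place_poly W (p W)" using insert.prems by auto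
  have "p W dvd a" using insert.prems maxideal_place_poly[OF W] by blast
  moreover have "\<not> p W dvd (\<Prod>V\<in>S. p V)"
  proof
    assume "p W dvd (\<Prod>V\<in>S. p V)"
    then obtain V where "V \<in> S" "p W dvd p V"
      using prime_elem_dvd_prod[OF pr] by blast
    then show False
      using place_poly_unique[OF W, of V "p V"] insert by blast
  qed
  ultimately have "p W dvd k"
    using pr k by (simp add: prime_elem_dvd_mult_iff)
  then show ?case using k insert(1,2) by (auto simp: mult.commute intro: mult_dvd_mono)
qed auto

lemma degree_prod_place_poly:
  assumes "finite S" and "\<And>V. V \<in> S \<Longrightarrow> is_place UNIV V \<and> xvar \<in> V \<and> place_poly V (p V)"
    and "\<And>V. V \<in> S \<Longrightarrow> to_fract a \<in> maxideal V" and "a \<noteq> 0"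
  shows "(\<Sum>V\<in>S. degree (p V)) \<le> degree a"
proof -
  have "degree (\<Prod>V\<in>S. p V) \<le> degree a"
    using dvd_imp_degree_le[OF prod_place_poly_dvd[OF assms(1-3)] assms(4)] by blast
  moreover have "degree (\<Prod>V\<in>S. p V) = (\<Sum>V\<in>S. degree (p V))"
    using assms by (intro degree_prod_eq_sum_degree) (auto simp: place_poly_def)
  ultimately show ?thesis by simp
qed

text \<open>Each zero contributes a prime polynomial of degree at least one, and the product of
  these primes divides \<open>a\<close>.\<close>

lemma card_zeros_le_degree:
  assumes "finite S" and "\<And>V. V \<in> S \<Longrightarrow> is_place UNIV V \<and> xvar \<in> V"
    and "\<And>V. V \<in> S \<Longrightarrow> to_fract a \<in> maxideal V" and "a \<noteq> 0"
  shows "card S \<le> degree a"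
proof -
  have ex: "\<forall>V\<in>S. \<exists>p. place_poly V p" using place_poly_exists assms(2) by blast
  obtain p where p: "\<And>V. V \<in> S \<Longrightarrow> place_poly V (p V)"
    using bchoice[OF ex] by blast
  have "card S = (\<Sum>V\<in>S. 1)" by simp
  also have "\<dots> \<le> (\<Sum>V\<in>S. degree (p V))"
    using place_poly_degree p assms(2) by (intro sum_mono) blast
  also have "\<dots> \<le> degree a"
    using degree_prod_place_poly[of S p a] assms p by blast
  finally show ?thesis .
qed

section \<open>Existence of finite places and functions without finite poles\<close>

lemma exists_irreducible_dvd:
  fixes a :: "'a::field poly"
  assumes "degree a > 0"
  shows "\<exists>p. irreducible p \<and> p dvd a"
  using assms
proof (induction "degree a" arbitrary: a rule: less_induct)
  case less
  show ?case
  proof (cases "irreducible a")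
    case False
    moreover have "a \<noteq> 0" using less.prems by auto
    moreover have "\<not> is_unit a" using less.prems \<open>a \<noteq> 0\<close> by (simp add: is_unit_iff_degree)
    ultimately obtain b c where bc: "a = b * c" "\<not> is_unit b" "\<not> is_unit c"
      by (auto simp: irreducible_def)
    then have "b \<noteq> 0" "c \<noteq> 0" using \<open>a \<noteq> 0\<close> by auto
    then have "degree b > 0" "degree c > 0" using bc by (auto simp: is_unit_iff_degree)
    moreover have "degree a = degree b + degree c"
      using bc \<open>b \<noteq> 0\<close> \<open>c \<noteq> 0\<close> by (simp add: degree_mult_eq)
    ultimately obtain p where "irreducible p" "p dvd b" using less.hyps[of b] by auto
    then show ?thesis using bc by auto
  qed auto
qed

lemma is_place_irreducible:
  fixes p :: "'a::field poly"
  assumes "irreducible p"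
  shows "is_place UNIV {f. \<exists>a b. f = to_fract a / to_fract b \<and> \<not> p dvd b}" (is "is_place UNIV ?V")
proof -
  have pr: "prime_elem p" by (rule field_poly_irreducible_imp_prime[OF assms])
  then have p0: "p \<noteq> 0" and pu: "\<not> p dvd 1" by (auto simp: prime_elem_def)
  have nz: "\<not> p dvd b \<Longrightarrow> to_fract b \<noteq> 0" for b by auto
  have inV: "to_fract a / to_fract b \<in> ?V" if "\<not> p dvd b" for a b using that by blast
  show ?thesis
    unfolding is_place_def
  proof (intro conjI ballI allI impI)
    show "const c \<in> ?V" for c
      using inV[OF pu, of "[:c:]"] by (simp add: const_to_fract)
    fix f assume "f \<in> ?V"
    then obtain a b where f: "f = to_fract a / to_fract b" "\<not> p dvd b" by blast
    show "- f \<in> ?V" using inV[OF f(2), of "- a"] f by simp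
    fix g assume "g \<in> ?V"
    then obtain c d where g: "g = to_fract c / to_fract d" "\<not> p dvd d" by blast
    have nd: "\<not> p dvd b * d" using f g pr by (simp add: prime_elem_dvd_mult_iff)
    have "f + g = to_fract (a * d + c * b) / to_fract (b * d)"
      using f g nz by (simp add: field_simps)
    then show "f + g \<in> ?V" by (simp only: inV[OF nd])
    show "f * g \<in> ?V"
      using inV[OF nd, of "a * c"] f g by simp
  next
    have "1 / to_fract p \<notin> ?V"
    proof
      assume "1 / to_fract p \<in> ?V"
      then obtain a b where *: "1 / to_fract p = to_fract a / to_fract b" "\<not> p dvd b" by blast
      then have "to_fract b = to_fract (p * a)" using p0 nz by (simp add: field_simps)
      then have "b = p * a" by (simp only: to_fract_eq_iff)
      then show False using * by simp
    qed
    then show "?V \<noteq> UNIV" by blast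
  next
    fix f :: "'a ratfun"
    assume f0: "f \<noteq> 0"
    obtain a b where f: "f = to_fract a / to_fract b" "b \<noteq> 0" by (rule ratfun_cases)
    then have "a \<noteq> 0" using f0 by auto
    have "degree p > 0" using p0 pu pr by (metis is_unit_iff_degree not_gr_zero prime_elem_def)
    \<comment> \<open>A common factor \<open>p\<close> is cancelled until numerator or denominator
      is free of it; the degree of the denominator drops each time.\<close>
    with f \<open>a \<noteq> 0\<close> show "f \<in> ?V \<or> inverse f \<in> ?V"
    proof (induction "degree b" arbitrary: a b rule: less_induct)
      case less
      show ?case
      proof (cases "p dvd a \<and> p dvd b")
        case True
        then obtain a' b' where e: "a = p * a'" "b = p * b'" by (auto elim!: dvdE)
        then have "a' \<noteq> 0" "b' \<noteq> 0" using less.prems by auto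
        moreover have "f = to_fract a' / to_fract b'" using less.prems e p0 by simp
        moreover have "degree b' < degree b"
          using e less.prems \<open>b' \<noteq> 0\<close> p0 by (simp add: degree_mult_eq)
        ultimately show ?thesis using less.hyps[of b' a'] less.prems by blast
      next
        case False
        then consider "\<not> p dvd a" | "\<not> p dvd b" by blast
        then show ?thesis
        proof cases
          case 1
          then show ?thesis using inV[OF 1, of b] less.prems by simp
        next
          case 2
          then show ?thesis using inV[OF 2, of a] less.prems by simp
        qed
      qed
    qed
  qed auto
qed

text \<open>If a denominator of least degree had an irreducible factor \<open>p\<close>, regularity
  at the place of \<open>p\<close> would let \<open>p\<close> be cancelled. So the denominator is
  constant.\<close>

lemma finite_places_imp_poly:
  fixes f :: "'a::field ratfun"
  assumes "\<And>V. is_place UNIV V \<Longrightarrow> xvar \<in> V \<Longrightarrow> f \<in> V"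
  shows "\<exists>a. f = to_fract a"
proof -
  obtain a0 b0 where "f = to_fract a0 / to_fract b0" "b0 \<noteq> 0" by (rule ratfun_cases)
  then have "\<exists>a. b0 \<noteq> 0 \<and> f = to_fract a / to_fract b0" by blast
  from arg_min_nat_lemma[of "\<lambda>b. \<exists>a. b \<noteq> 0 \<and> f = to_fract a / to_fract b" b0 degree, OF this]
  obtain a b where ab: "b \<noteq> 0" "f = to_fract a / to_fract b"
    and least: "\<And>a' b'. b' \<noteq> 0 \<Longrightarrow> f = to_fract a' / to_fract b' \<Longrightarrow> degree b \<le> degree b'" by blast
  show ?thesis
  proof (cases "degree b > 0")
    case True
    then obtain p where p: "irreducible p" "p dvd b" using exists_irreducible_dvd by blast
    have pr: "prime_elem p" by (rule field_poly_irreducible_imp_prime[OF p(1)])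
    define V where "V = {f. \<exists>a b. f = to_fract a / to_fract b \<and> \<not> p dvd b}"
    have V: "is_place UNIV V" unfolding V_def by (rule is_place_irreducible[OF p(1)])
    have "\<not> p dvd 1" using pr by (simp add: prime_elem_def)
    then have "xvar \<in> V" unfolding V_def
      by (intro CollectI exI[of _ "[:0,1:]"] exI[of _ 1]) (simp add: xvar_to_fract)
    then have "f \<in> V" using assms V by blast
    then obtain c d where cd: "f = to_fract c / to_fract d" "\<not> p dvd d" unfolding V_def by blast
    then have "d \<noteq> 0" by auto
    then have "to_fract (a * d) = to_fract (c * b)" using ab cd by (simp add: field_simps)
    then have "p dvd a * d" using p(2) by (simp only: to_fract_eq_iff dvd_mult)
    then have "p dvd a" using cd pr by (simp add: prime_elem_dvd_mult_iff)
    then obtain a' b' where e: "a = p * a'" "b = p * b'" using p by (auto elim!: dvdE)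
    have "p \<noteq> 0" using pr by auto
    have "b' \<noteq> 0" "f = to_fract a' / to_fract b'" using e ab \<open>p \<noteq> 0\<close> by auto
    moreover have "degree b = degree p + degree b'"
      using e \<open>p \<noteq> 0\<close> \<open>b' \<noteq> 0\<close> by (simp add: degree_mult_eq)
    moreover have "degree p > 0"
      using \<open>p \<noteq> 0\<close> pr by (metis is_unit_iff_degree not_gr_zero prime_elem_def)
    ultimately show ?thesis using least[of b' a'] by simp
  next
    case False
    then obtain c where c: "b = [:c:]" using degree_eq_zeroE by blast
    then have "f = to_fract (smult (inverse c) a)"
    proof -
      have "a = b * smult (inverse c) a" using c ab by simp
      then have "to_fract a = to_fract b * to_fract (smult (inverse c) a)"
        by (metis to_fract_mult)
      then show ?thesis using ab by simp
    qed
    then show ?thesis by blast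
  qed
qed

section \<open>Automorphisms\<close>

context
  fixes \<sigma> :: "'a::field ratfun \<Rightarrow> 'a ratfun"
  assumes aut: "is_aut \<sigma>"
begin

lemma aut_add: "\<sigma> (f + g) = \<sigma> f + \<sigma> g"
  using aut by (simp add: is_aut_def)

lemma aut_mult: "\<sigma> (f * g) = \<sigma> f * \<sigma> g"
  using aut by (simp add: is_aut_def)

lemma aut_const: "\<sigma> (const c) = const c"
  using aut by (simp add: is_aut_def)

lemma aut_0: "\<sigma> 0 = 0"
  using aut_const[of 0] by simp

lemma aut_1: "\<sigma> 1 = 1"
  using aut_const[of 1] by simp

lemma aut_uminus: "\<sigma> (- f) = - \<sigma> f"
  using minus_unique[of "\<sigma> f" "\<sigma> (- f)"] aut_add[of f "- f"] by (simp add: aut_0)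

lemma aut_diff: "\<sigma> (f - g) = \<sigma> f - \<sigma> g"
  using aut_add[of f "- g"] by (simp add: aut_uminus)

lemma aut_inverse: "\<sigma> (inverse f) = inverse (\<sigma> f)"
proof (cases "f = 0")
  case False
  then have "\<sigma> f * \<sigma> (inverse f) = 1" by (simp add: aut_1 flip: aut_mult)
  then show ?thesis by (metis inverse_unique)
qed (simp add: aut_0)

lemma is_aut_inv: "is_aut (inv \<sigma>)"
proof -
  have b: "bij \<sigma>" using aut by (simp add: is_aut_def)
  then have s: "\<sigma> (inv \<sigma> f) = f" and i: "inv \<sigma> (\<sigma> f) = f" for f
    by (simp_all add: bij_is_surj surj_f_inv_f bij_is_inj)
  have "inv \<sigma> (f + g) = inv \<sigma> f + inv \<sigma> g" for f g
    using i[of "inv \<sigma> f + inv \<sigma> g"] by (simp add: aut_add s)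
  moreover have "inv \<sigma> (f * g) = inv \<sigma> f * inv \<sigma> g" for f g
    using i[of "inv \<sigma> f * inv \<sigma> g"] by (simp add: aut_mult s)
  moreover have "inv \<sigma> (const c) = const c" for c
    using i[of "const c"] by (simp add: aut_const)
  ultimately show ?thesis using b bij_imp_bij_inv by (auto simp: is_aut_def)
qed

lemma aut_inv_right: "\<sigma> (inv \<sigma> f) = f"
  using aut by (simp add: is_aut_def bij_is_surj surj_f_inv_f)

lemma aut_inv_left: "inv \<sigma> (\<sigma> f) = f"
  using aut by (simp add: is_aut_def bij_is_inj)

lemma is_place_vimage:
  assumes V: "is_place UNIV V"
  shows "is_place UNIV (\<sigma> -` V)"
proof -
  obtain f where "f \<notin> V" using V by (auto simp: is_place_def)
  then have "inv \<sigma> f \<notin> \<sigma> -` V" by (simp add: aut_inv_right)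
  then have "\<sigma> -` V \<noteq> UNIV" by blast
  moreover have "\<sigma> f \<in> V \<or> inverse (\<sigma> f) \<in> V" for f
    using place_inverse[OF V] maxideal_subset[OF V] by blast
  ultimately show ?thesis
    using place_add[OF V] place_mult[OF V] place_uminus[OF V] place_const[OF V]
    by (auto simp: is_place_def aut_add aut_mult aut_uminus aut_const aut_inverse)
qed

lemma maxideal_vimage: "maxideal (\<sigma> -` V) = \<sigma> -` maxideal V"
proof -
  have "\<sigma> f = 0 \<longleftrightarrow> f = 0" for f using aut_inv_left[of f] aut_inv_left[of 0] by (auto simp: aut_0)
  then show ?thesis by (auto simp: maxideal_def aut_inverse)
qed

end

section \<open>Automorphisms as Moebius transformations\<close>

lemma Pinf_value:
  assumes "f \<in> Pinf"
  shows "\<exists>c. f - const c \<in> maxideal Pinf"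
proof -
  obtain a b where f: "f = to_fract a / to_fract b" "b \<noteq> 0" by (rule ratfun_cases)
  then have d: "degree a \<le> degree b" using assms Pinf_iff by auto
  \<comment> \<open>The value at infinity. The coefficient of \<open>a\<close> is taken at
    \<open>degree b\<close>, so that it is zero when \<open>a\<close> has smaller degree.\<close>
  define c where "c = coeff a (degree b) / lead_coeff b"
  define e where "e = a - smult c b"
  have "smult c b = [:c:] * b" by simp
  then have "to_fract e = to_fract a - const c * to_fract b"
    unfolding e_def const_to_fract by (metis to_fract_diff to_fract_mult)
  then have eq: "f - const c = to_fract e / to_fract b"
    using f by (simp add: field_simps)
  have "e = 0 \<or> degree e < degree b"
  proof (rule ccontr)
    assume *: "\<not> (e = 0 \<or> degree e < degree b)"
    have "degree e \<le> degree b"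
      unfolding e_def using d by (intro degree_diff_le) (auto intro: order_trans[OF degree_smult_le])
    then have "degree e = degree b" using * by simp
    moreover have "coeff e (degree b) = 0" using f by (simp add: e_def c_def)
    ultimately show False using * by (metis leading_coeff_0_iff)
  qed
  then have "f - const c \<in> maxideal Pinf"
  proof
    assume "e = 0"
    then show ?thesis using eq maxideal_0[OF is_place_Pinf] by simp
  next
    assume *: "degree e < degree b"
    show ?thesis
    proof (cases "e = 0")
      case False
      then show ?thesis
        using Pinf_iff[of b e] Pinf_iff[of e b] * f eq by (simp add: maxideal_def)
    qed (simp add: eq maxideal_0[OF is_place_Pinf])
  qed
  then show ?thesis by blast
qed

lemma degree_le_1_iff_Pinf: "to_fract a / xvar \<in> Pinf \<longleftrightarrow> degree a \<le> 1"
  using Pinf_iff[of "[:0, 1:]" a] by (simp add: xvar_to_fract)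

lemma xvar_nonzero: "xvar \<noteq> 0"
  by (simp add: xvar_to_fract)

lemma inverse_xvar_maxideal_Pinf: "inverse xvar \<in> maxideal Pinf"
  by (rule place_inverse[OF is_place_Pinf _ xvar_notin_Pinf]) simp

text \<open>The image of the place at infinity is again a rational place \<open>W\<close>, and \<open>\<sigma> x\<close> has its only
  pole there, of order one.\<close>

lemma aut_xvar_moebius:
  assumes aut: "is_aut \<sigma>"
  shows "\<exists>a b. b \<noteq> 0 \<and> degree a \<le> 1 \<and> degree b \<le> 1 \<and> \<sigma> xvar = to_fract a / to_fract b"
proof -
  define \<tau> where "\<tau> = inv \<sigma>"
  have \<tau>: "is_aut \<tau>" unfolding \<tau>_def by (rule is_aut_inv[OF aut])
  have st: "\<sigma> (\<tau> f) = f" and ts: "\<tau> (\<sigma> f) = f" for f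
    using aut_inv_right[OF aut] aut_inv_left[OF aut] by (simp_all add: \<tau>_def)
  define W where "W = \<tau> -` (Pinf :: 'a ratfun set)"
  have W: "is_place UNIV W" unfolding W_def by (rule is_place_vimage[OF \<tau> is_place_Pinf])
  have W2: "\<sigma> -` W = Pinf" by (auto simp: W_def ts)
  have reg: "\<sigma> xvar \<in> V" if V: "is_place UNIV V" and "V \<noteq> W" for V
  proof -
    have "\<sigma> -` V \<noteq> Pinf"
    proof
      assume "\<sigma> -` V = Pinf"
      then have "\<tau> -` (\<sigma> -` V) = W" by (simp add: W_def)
      then show False using \<open>V \<noteq> W\<close> by (auto simp: st)
    qed
    then show ?thesis using place_xvar_iff[OF is_place_vimage[OF aut V]] by simp
  qed
  show ?thesis
  proof (cases "xvar \<in> W")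
    case False
    then have WP: "W = Pinf" using place_eq_Pinf[OF W] by simp
    obtain h where h: "\<sigma> xvar = to_fract h"
      using finite_places_imp_poly[of "\<sigma> xvar"] reg WP xvar_notin_Pinf by blast
    have "\<tau> (inverse xvar) \<in> maxideal Pinf"
      using inverse_xvar_maxideal_Pinf WP maxideal_vimage[OF \<tau>, of Pinf] by (auto simp: W_def)
    then have "\<tau> (inverse xvar) * xvar \<in> \<sigma> -` Pinf"
      using maxideal_Pinf_mult_xvar W2 WP by simp
    then have "inverse xvar * \<sigma> xvar \<in> Pinf"
      by (simp add: aut_mult[OF aut] st)
    then have "degree h \<le> 1"
      using degree_le_1_iff_Pinf[of h] h by (simp add: field_simps)
    then show ?thesis using h by (intro exI[of _ h] exI[of _ 1]) simp
  next
    case True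
    then have WP: "W \<noteq> Pinf" using xvar_notin_Pinf by blast
    \<comment> \<open>\<open>c\<close> is the residue of \<open>xvar\<close> at \<open>W\<close>,
      read off at infinity from \<open>\<tau> xvar\<close>.\<close>
    obtain c where "\<tau> xvar - const c \<in> maxideal Pinf"
      using Pinf_value[of "\<tau> xvar"] True by (auto simp: W_def)
    then have c: "\<tau> (xvar - const c) * xvar \<in> Pinf"
      using maxideal_Pinf_mult_xvar by (simp add: aut_diff[OF \<tau>] aut_const[OF \<tau>])
    have xc: "xvar - const c = to_fract [:- c, 1:]"
      by (simp add: const_to_fract xvar_to_fract flip: to_fract_diff)
    \<comment> \<open>The factor \<open>xvar - const c\<close> cancels the simple pole of
      \<open>\<sigma> xvar\<close> at \<open>W\<close>, so \<open>H\<close> is a polynomial.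
      Regularity of \<open>\<sigma> xvar\<close> at infinity then bounds its degree by one.\<close>
    define H where "H = (xvar - const c) * \<sigma> xvar"
    have "H \<in> V" if V: "is_place UNIV V" and x: "xvar \<in> V" for V
    proof (cases "V = W")
      case True
      have "\<tau> H \<in> Pinf" using c by (simp add: H_def aut_mult[OF \<tau>] ts)
      then show ?thesis using True by (simp add: W_def)
    next
      case False
      then show ?thesis unfolding H_def xc
        using place_mult[OF V place_to_fract[OF V x] reg[OF V]] by blast
    qed
    then obtain h where h: "H = to_fract h" using finite_places_imp_poly[of H] by blast
    have "to_fract [:- c, 1:] / xvar \<in> Pinf" by (simp only: degree_le_1_iff_Pinf) simp
    then have "to_fract [:- c, 1:] / xvar * \<sigma> xvar \<in> Pinf"
      using place_mult[OF is_place_Pinf] reg[OF is_place_Pinf] WP by blast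
    then have "to_fract h / xvar \<in> Pinf"
      by (simp add: xc flip: h H_def) (simp add: H_def xc)
    then have "degree h \<le> 1" by (simp only: degree_le_1_iff_Pinf)
    moreover have "\<sigma> xvar = to_fract h / to_fract [:- c, 1:]"
      unfolding h[symmetric] H_def xc by simp
    ultimately show ?thesis by (intro exI[of _ h] exI[of _ "[:- c, 1:]"]) simp
  qed
qed

section \<open>Products of linear factors\<close>

text \<open>The recursion on which the inductions over the number of linear factors rest.\<close>

lemma coeff_linear_mult:
  "coeff ([:- u, 1:] * P) k = - u * coeff P k + (case k of 0 \<Rightarrow> 0 | Suc m \<Rightarrow> coeff P m)"
  for P :: "'b::comm_ring_1 poly"
  by (simp add: coeff_pCons split: nat.split)

lemma aut_coeff_prod_linear:
  assumes aut: "is_aut \<tau>"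
  shows "\<tau> (coeff (\<Prod>i\<in>S. [:- u i, 1:]) k) = coeff (\<Prod>i\<in>S. [:- \<tau> (u i), 1:]) k"
proof (induction S arbitrary: k rule: infinite_finite_induct)
  case (insert i S)
  then show ?case
    by (simp only: prod.insert[OF insert.hyps(1,2)] coeff_linear_mult)
      (simp add: aut_add[OF aut] aut_diff[OF aut] aut_uminus[OF aut] aut_mult[OF aut] aut_0[OF aut] split: nat.split)
qed (auto simp: aut_0[OF aut] aut_1[OF aut])

lemma coeff_prod_linear_in_place:
  assumes V: "is_place UNIV V" and "\<And>i. i \<in> S \<Longrightarrow> u i \<in> V"
  shows "coeff (\<Prod>i\<in>S. [:- u i, 1:]) k \<in> V"
  using assms(2)
proof (induction S arbitrary: k rule: infinite_finite_induct)
  case (insert i S)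
  then have "- u i * coeff (\<Prod>i\<in>S. [:- u i, 1:]) k \<in> V"
    by (intro place_mult[OF V] place_uminus[OF V]) auto
  moreover have "(case k of 0 \<Rightarrow> 0 | Suc m \<Rightarrow> coeff (\<Prod>i\<in>S. [:- u i, 1:]) m) \<in> V"
    using insert place_0[OF V] by (auto split: nat.split)
  ultimately show ?case
    by (simp only: prod.insert[OF insert.hyps(1,2)] coeff_linear_mult place_add[OF V])
qed (auto simp: place_0[OF V] place_1[OF V])

text \<open>The product of the \<open>b i\<close> is a common denominator of all coefficients. A new
  factor multiplies the numerators by \<open>a i\<close> or \<open>b i\<close>, so their degrees
  grow by at most one. The induction runs over all \<open>k\<close> at once because the recursion
  mixes neighbouring coefficients.\<close>

lemma coeff_prod_linear_denominator:
  assumes "\<And>i. i \<in> S \<Longrightarrow> b i \<noteq> 0 \<and> degree (a i) \<le> 1 \<and> degree (b i) \<le> 1"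
    and "finite S"
  shows "\<exists>c. degree c \<le> card S \<and>
    coeff (\<Prod>i\<in>S. [:- (to_fract (a i) / to_fract (b i)), 1:]) k * to_fract (\<Prod>i\<in>S. b i) = to_fract c"
  using assms(2,1)
proof (induction S arbitrary: k)
  case empty
  show ?case by (intro exI[of _ "if k = 0 then 1 else 0"]) auto
next
  case (insert i S)
  define P where "P = (\<Prod>i\<in>S. [:- (to_fract (a i) / to_fract (b i)), 1:])"
  define D where "D = (\<Prod>i\<in>S. b i)"
  have "\<forall>k. \<exists>c. degree c \<le> card S \<and> coeff P k * to_fract D = to_fract c"
    using insert unfolding P_def D_def by blast
  then obtain c where c: "\<And>k. degree (c k) \<le> card S" "\<And>k. coeff P k * to_fract D = to_fract (c k)"
    by metis
  define c' where "c' = - a i * c k + (case k of 0 \<Rightarrow> 0 | Suc m \<Rightarrow> b i * c m)"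
  have i: "b i \<noteq> 0" "degree (a i) \<le> 1" "degree (b i) \<le> 1" using insert.prems by auto
  have "degree (e * c j) \<le> Suc (card S)" if "degree e \<le> 1" for e j
    using degree_mult_le[of e "c j"] that c(1)[of j] by linarith
  from this[of "- a i"] this[OF i(3)] have "degree c' \<le> Suc (card S)"
    unfolding c'_def using i by (intro degree_add_le) (auto split: nat.split)
  moreover have "(- (to_fract (a i) / to_fract (b i)) * coeff P k + (case k of 0 \<Rightarrow> 0 | Suc m \<Rightarrow> coeff P m))
      * to_fract (b i * D) = to_fract c'"
  proof -
    have "- (to_fract (a i) / to_fract (b i)) * coeff P k * to_fract (b i * D) = to_fract (- a i * c k)"
      using i c(2)[of k] by (simp add: field_simps)
    moreover have "(case k of 0 \<Rightarrow> 0 | Suc m \<Rightarrow> coeff P m) * to_fract (b i * D) =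
        to_fract (case k of 0 \<Rightarrow> 0 | Suc m \<Rightarrow> b i * c m)"
      using c(2) by (auto split: nat.split simp: mult.left_commute)
    ultimately show ?thesis unfolding c'_def to_fract_add distrib_right by (simp only:)
  qed
  ultimately show ?case
    by (intro exI[of _ c']) (simp only: prod.insert[OF insert.hyps(1,2)] coeff_linear_mult
        card_insert_disjoint[OF insert.hyps(1,2)] P_def[symmetric] D_def[symmetric] simp_thms)
qed

section \<open>The fixed field\<close>

text \<open>For a finite group \<open>G\<close>, the characteristic polynomial of \<open>f\<close>
  over the fixed field.\<close>

definition orbit_poly :: "('a::field ratfun \<Rightarrow> 'a ratfun) set \<Rightarrow> 'a ratfun \<Rightarrow> 'a ratfun poly" where
  "orbit_poly G f = (\<Prod>\<sigma>\<in>G. [:- \<sigma> f, 1:])"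

context
  fixes G :: "('a::field ratfun \<Rightarrow> 'a ratfun) set"
  assumes G: "aut_subgroup G" and fin: "finite G"
begin

lemma group_aut: "\<sigma> \<in> G \<Longrightarrow> is_aut \<sigma>"
  using G by (simp add: aut_subgroup_def)

lemma group_card_pos: "card G > 0"
  using G fin by (auto simp: aut_subgroup_def card_gt_0_iff)

lemma fixed_field_const: "const c \<in> fixed_field G"
  using aut_const[OF group_aut] by (simp add: fixed_field_def)

lemma fixed_field_add: "f \<in> fixed_field G \<Longrightarrow> g \<in> fixed_field G \<Longrightarrow> f + g \<in> fixed_field G"
  using aut_add[OF group_aut] unfolding fixed_field_def mem_Collect_eq by metis

lemma fixed_field_uminus: "f \<in> fixed_field G \<Longrightarrow> - f \<in> fixed_field G"
  using aut_uminus[OF group_aut] unfolding fixed_field_def mem_Collect_eq by metis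

lemma fixed_field_mult: "f \<in> fixed_field G \<Longrightarrow> g \<in> fixed_field G \<Longrightarrow> f * g \<in> fixed_field G"
  using aut_mult[OF group_aut] unfolding fixed_field_def mem_Collect_eq by metis

lemma fixed_field_inverse: "f \<in> fixed_field G \<Longrightarrow> inverse f \<in> fixed_field G"
  using aut_inverse[OF group_aut] unfolding fixed_field_def mem_Collect_eq by metis

lemma fixed_field_power: "f \<in> fixed_field G \<Longrightarrow> f ^ n \<in> fixed_field G"
  using fixed_field_const[of 1] by (induction n) (auto intro: fixed_field_mult)

lemma fixed_field_sum: "(\<And>i. i \<in> A \<Longrightarrow> f i \<in> fixed_field G) \<Longrightarrow> sum f A \<in> fixed_field G"
  using fixed_field_const[of 0] by (induction A rule: infinite_finite_induct) (auto intro: fixed_field_add)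

text \<open>Applying \<open>\<tau>\<close> to the coefficients only permutes the linear factors, as
  left composition with \<open>\<tau>\<close> is a bijection of \<open>G\<close>.\<close>

lemma coeff_orbit_poly_fixed: "coeff (orbit_poly G f) k \<in> fixed_field G"
  unfolding fixed_field_def
proof (intro CollectI ballI)
  fix \<tau> assume \<tau>: "\<tau> \<in> G"
  have "bij_betw (\<lambda>\<sigma>. \<tau> \<circ> \<sigma>) G G"
  proof (rule bij_betw_byWitness[where f' = "\<lambda>\<sigma>. inv \<tau> \<circ> \<sigma>"])
    show "(\<lambda>\<sigma>. \<tau> \<circ> \<sigma>) ` G \<subseteq> G" "(\<lambda>\<sigma>. inv \<tau> \<circ> \<sigma>) ` G \<subseteq> G"
      using G \<tau> by (auto simp: aut_subgroup_def)
  qed (auto simp: fun_eq_iff aut_inv_left[OF group_aut[OF \<tau>]] aut_inv_right[OF group_aut[OF \<tau>]])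
  then have "(\<Prod>\<sigma>\<in>G. [:- (\<tau> \<circ> \<sigma>) f, 1:]) = (\<Prod>\<sigma>\<in>G. [:- \<sigma> f, 1:])"
    by (rule prod.reindex_bij_betw)
  then show "\<tau> (coeff (orbit_poly G f) k) = coeff (orbit_poly G f) k"
    using aut_coeff_prod_linear[OF group_aut[OF \<tau>], of "\<lambda>\<sigma>. \<sigma> f" G k] by (simp add: orbit_poly_def)
qed

lemma degree_orbit_poly: "degree (orbit_poly G f) = card G"
  by (simp add: orbit_poly_def degree_prod_eq_sum_degree)

lemma lead_coeff_orbit_poly: "coeff (orbit_poly G f) (card G) = 1"
proof -
  have "lead_coeff (orbit_poly G f) = 1" by (simp add: orbit_poly_def lead_coeff_prod)
  then show ?thesis by (simp add: degree_orbit_poly)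
qed

lemma orbit_poly_root: "f ^ card G + (\<Sum>k<card G. coeff (orbit_poly G f) k * f ^ k) = 0"
proof -
  have "id \<in> G" using G by (simp add: aut_subgroup_def)
  then have "poly (orbit_poly G f) f = 0"
    using fin by (auto simp: orbit_poly_def poly_prod intro!: prod_zero bexI[of _ id])
  then show ?thesis
    by (simp add: poly_altdef degree_orbit_poly lead_coeff_orbit_poly add.commute flip: lessThan_Suc_atMost)
qed

text \<open>Valuation rings are integrally closed: if \<open>f\<close> had a pole, multiplying its
  equation by \<open>inverse f ^ n\<close> would put 1 into the maximal ideal.\<close>

lemma orbit_poly_integral:
  assumes V: "is_place UNIV V" and "\<And>k. coeff (orbit_poly G f) k \<in> V"
  shows "f \<in> V"
proof (rule ccontr)
  assume nf: "f \<notin> V"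
  define n where "n = card G"
  define c where "c = coeff (orbit_poly G f)"
  have y: "inverse f \<in> maxideal V" by (rule place_inverse[OF V _ nf]) simp
  have f0: "f \<noteq> 0" using nf place_0[OF V] by auto
  have "(f ^ n + (\<Sum>k<n. c k * f ^ k)) * inverse f ^ n = 0"
    using orbit_poly_root[of f] by (simp add: n_def c_def)
  then have "1 + (\<Sum>k<n. c k * f ^ k * inverse f ^ n) = 0"
    using f0 by (simp add: distrib_right sum_distrib_right flip: power_mult_distrib)
  moreover have "(\<Sum>k<n. c k * f ^ k * inverse f ^ n) \<in> maxideal V"
  proof (rule maxideal_sum[OF V])
    fix k assume "k \<in> {..<n}"
    then obtain j where j: "n = k + Suc j" by (metis lessThan_iff less_iff_Suc_add add_Suc_right)
    have "f ^ k * inverse f ^ n = (f * inverse f) ^ k * inverse f ^ Suc j"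
      by (simp only: j power_add power_mult_distrib mult.assoc)
    then have "f ^ k * inverse f ^ n = inverse f ^ j * inverse f"
      using f0 by simp
    then have "c k * f ^ k * inverse f ^ n = c k * inverse f ^ j * inverse f"
      by (simp only: mult.assoc)
    moreover have "c k * inverse f ^ j \<in> V"
      using assms(2) place_mult[OF V] place_power[OF V maxideal_subset[OF V y]]
      unfolding c_def by blast
    ultimately show "c k * f ^ k * inverse f ^ n \<in> maxideal V"
      by (simp only: maxideal_mult_left[OF V _ y])
  qed
  moreover define S where "S = (\<Sum>k<n. c k * f ^ k * inverse f ^ n)"
  ultimately have "1 = - S" "- S \<in> maxideal V"
    using maxideal_uminus[OF V] by (simp_all only: eq_neg_iff_add_eq_0)
  then show False using one_notin_maxideal[OF V] by (simp only:)
qed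

lemma maxideal_contraction: "maxideal (V \<inter> fixed_field G) = maxideal V \<inter> fixed_field G"
  using fixed_field_inverse by (auto simp: maxideal_def)

lemma eval_at_contraction:
  assumes V: "is_place UNIV V" and f: "f \<in> fixed_field G" and c: "f - const c \<in> maxideal V"
  shows "eval_at (V \<inter> fixed_field G) f = c"
proof -
  have "f - const d = f + const (- d)" for d by (simp add: const_uminus)
  then have "f - const d \<in> fixed_field G" for d
    using fixed_field_add[OF f fixed_field_const] by (simp only:)
  then show ?thesis
    using eval_at_eqI[OF V c] by (simp add: eval_at_def maxideal_contraction)
qed

text \<open>The point is properness: were the contraction the whole fixed field, all orbit
  polynomials would have coefficients in \<open>V\<close>, and integrality would give
  \<open>V = UNIV\<close>.\<close>

lemma is_place_contraction:
  assumes V: "is_place UNIV V"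
  shows "is_place (fixed_field G) (V \<inter> fixed_field G)"
proof -
  obtain f where "f \<notin> V" using V by (auto simp: is_place_def)
  then obtain k where "coeff (orbit_poly G f) k \<notin> V" using orbit_poly_integral[OF V] by blast
  then have "V \<inter> fixed_field G \<noteq> fixed_field G" using coeff_orbit_poly_fixed by blast
  moreover have "f \<in> V \<or> inverse f \<in> V" for f
    using place_inverse[OF V] maxideal_subset[OF V] by blast
  ultimately show ?thesis
    using place_add[OF V] place_mult[OF V] place_uminus[OF V] place_const[OF V]
      fixed_field_const fixed_field_add fixed_field_mult fixed_field_uminus fixed_field_inverse
    by (auto simp: is_place_def)
qed

text \<open>Conjugate places have the same place below them, since \<open>\<sigma>\<close> fixes
  \<open>fixed_field G\<close> pointwise.\<close>

lemma vimage_contraction: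
  assumes "\<sigma> \<in> G"
  shows "(\<sigma> -` V) \<inter> fixed_field G = V \<inter> fixed_field G"
  using assms by (auto simp: fixed_field_def)

end

section \<open>The place below infinity and functions with a pole there\<close>

lemma Pinf_power_bound:
  assumes "f \<in> maxideal Pinf"
  shows "\<exists>n. f ^ n * e \<in> Pinf"
proof -
  obtain a b where e: "e = to_fract a / to_fract b" "b \<noteq> 0" by (rule ratfun_cases)
  \<comment> \<open>Each factor \<open>f\<close> has order at least one at infinity, and the pole
    order of \<open>e\<close> is at most \<open>degree a\<close>.\<close>
  define n where "n = degree a"
  have "(f * xvar) ^ n \<in> Pinf"
    by (rule place_power[OF is_place_Pinf maxideal_Pinf_mult_xvar[OF assms]])
  moreover have "e * inverse xvar ^ n \<in> Pinf"
  proof -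
    have x: "xvar ^ n = to_fract (monom 1 n)"
      by (simp add: xvar_to_fract monom_altdef flip: to_fract_power)
    have "to_fract a / to_fract (b * monom 1 n) \<in> Pinf"
      using e by (subst Pinf_iff) (auto simp: n_def degree_mult_eq degree_monom_eq)
    then show ?thesis by (simp add: e divide_inverse x power_inverse mult.assoc)
  qed
  ultimately have "(f * xvar) ^ n * (e * inverse xvar ^ n) \<in> Pinf"
    by (rule place_mult[OF is_place_Pinf])
  moreover have "(f * xvar) ^ n * (e * inverse xvar ^ n) = f ^ n * e"
    by (simp add: power_mult_distrib power_inverse xvar_nonzero)
  ultimately show ?thesis by auto
qed

text \<open>Rationality of \<open>Q\<close> is not at hand, so discreteness of the order at infinity
  is used. If \<open>f\<close> in \<open>Q\<close> had a pole at infinity, \<open>inverse f\<close>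
  would be a unit of \<open>Q\<close>. But a power of it absorbs the pole of some \<open>e\<close>
  outside \<open>Q\<close>, which forces that power into the maximal ideal of
  \<open>Q\<close>.\<close>

lemma lies_over_Pinf:
  assumes "aut_subgroup G" "finite G" and Q: "is_place (fixed_field G) Q" and "lies_over Pinf Q"
  shows "Q = Pinf \<inter> fixed_field G"
proof -
  let ?F = "fixed_field G"
  have sub: "maxideal Q \<subseteq> maxideal Pinf" using assms by (simp add: lies_over_def)
  have nin: "f \<notin> Pinf" if "inverse f \<in> maxideal Pinf" "f \<noteq> 0" for f
    using that by (auto simp: maxideal_def)
  have "f \<in> Q" if f: "f \<in> Pinf" "f \<in> ?F" for f
  proof (rule ccontr)
    assume n: "f \<notin> Q"
    then have "f \<noteq> 0" using place_0[OF Q] by auto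
    then show False using nin[of f] place_inverse[OF Q f(2) n] sub f by blast
  qed
  moreover have "f \<in> Pinf" if f: "f \<in> Q" for f
  proof (rule ccontr)
    assume n: "f \<notin> Pinf"
    have fF: "f \<in> ?F" by (rule place_subset[OF Q f])
    have f0: "f \<noteq> 0" using n place_0[OF is_place_Pinf] by auto
    have m: "inverse f \<in> maxideal Pinf" by (rule place_inverse[OF is_place_Pinf _ n]) simp
    have "f \<notin> maxideal Q" using n sub maxideal_subset[OF is_place_Pinf] by blast
    then have y: "inverse f \<in> Q" using f f0 by (simp add: maxideal_def)
    obtain e where e: "e \<in> ?F" "e \<notin> Q" using Q by (auto simp: is_place_def)
    then have b: "inverse e \<in> maxideal Q" by (rule place_inverse[OF Q])
    have e0: "e \<noteq> 0" using e place_0[OF Q] by auto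
    obtain n where "inverse f ^ n * e \<in> Pinf" using Pinf_power_bound[OF m] by blast
    moreover have "inverse f ^ n * e \<in> ?F"
      using fixed_field_mult fixed_field_power fixed_field_inverse assms(1,2) fF e by metis
    ultimately have "inverse f ^ n * e \<in> Q" using \<open>\<And>f. f \<in> Pinf \<Longrightarrow> f \<in> ?F \<Longrightarrow> f \<in> Q\<close> by blast
    from maxideal_mult_right[OF Q b this] have "inverse e * (inverse f ^ n * e) \<in> maxideal Q" .
    moreover have "inverse e * (inverse f ^ n * e) = inverse f ^ n" using e0 by simp
    ultimately have "inverse f ^ n \<in> maxideal Q" by (simp only:)
    then have "inverse f \<in> maxideal Q" by (rule maxideal_power[OF Q y])
    then show False using f f0 by (simp add: maxideal_def)
  qed
  ultimately show ?thesis using place_subset[OF Q] by blast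
qed

text \<open>A coefficient \<open>w\<close> of the orbit polynomial of \<open>x\<close> having a pole at infinity plays the role of a
  generator of \<open>F\<close>: its degree as a rational function is at most \<open>[E : F]\<close>.\<close>

lemma fixed_field_pole:
  assumes G: "aut_subgroup G" and fin: "finite G"
  obtains C D where "D \<noteq> 0" "degree C \<le> card G" "degree D \<le> card G"
    "to_fract C / to_fract D \<in> fixed_field G" "to_fract C / to_fract D \<notin> Pinf"
proof -
  \<comment> \<open>\<open>xvar\<close> has a pole at infinity and is integral over the
    coefficients, so some coefficient has a pole there.\<close>
  obtain k where k: "coeff (orbit_poly G xvar) k \<notin> Pinf"
    using orbit_poly_integral[OF G fin is_place_Pinf] xvar_notin_Pinf by blast
  have "\<forall>\<sigma>\<in>G. \<exists>ab. snd ab \<noteq> 0 \<and> degree (fst ab) \<le> 1 \<and> degree (snd ab) \<le> 1 \<and>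
      \<sigma> xvar = to_fract (fst ab) / to_fract (snd ab)"
    using aut_xvar_moebius[OF group_aut[OF G fin]] by fastforce
  then obtain ab where ab: "\<And>\<sigma>. \<sigma> \<in> G \<Longrightarrow> snd (ab \<sigma>) \<noteq> 0 \<and> degree (fst (ab \<sigma>)) \<le> 1 \<and>
      degree (snd (ab \<sigma>)) \<le> 1 \<and> \<sigma> xvar = to_fract (fst (ab \<sigma>)) / to_fract (snd (ab \<sigma>))"
    by metis
  define D where "D = (\<Prod>\<sigma>\<in>G. snd (ab \<sigma>))"
  have eq: "orbit_poly G xvar = (\<Prod>\<sigma>\<in>G. [:- (to_fract (fst (ab \<sigma>)) / to_fract (snd (ab \<sigma>))), 1:])"
    unfolding orbit_poly_def using ab by (intro prod.cong) auto
  obtain C where C: "degree C \<le> card G" "coeff (orbit_poly G xvar) k * to_fract D = to_fract C"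
    using coeff_prod_linear_denominator[of G "\<lambda>\<sigma>. snd (ab \<sigma>)" "\<lambda>\<sigma>. fst (ab \<sigma>)" k] ab fin
    unfolding eq D_def by blast
  have "D \<noteq> 0" unfolding D_def using ab fin by simp
  moreover have "degree D \<le> card G"
  proof -
    have "degree D = (\<Sum>\<sigma>\<in>G. degree (snd (ab \<sigma>)))"
      unfolding D_def using ab by (intro degree_prod_eq_sum_degree) auto
    also have "\<dots> \<le> (\<Sum>\<sigma>\<in>G. 1)" using ab by (intro sum_mono) auto
    finally show ?thesis by simp
  qed
  moreover have "to_fract C / to_fract D = coeff (orbit_poly G xvar) k"
    using \<open>D \<noteq> 0\<close> by (simp flip: C(2))
  ultimately show thesis
    using that C k coeff_orbit_poly_fixed[OF G fin, of xvar k] by metis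
qed

text \<open>Multiplying \<open>g\<close> by \<open>D ^ m\<close> gives a polynomial \<open>A\<close>
  of degree at most \<open>m * card G\<close> that vanishes at every place of \<open>S\<close>. The
  statement speaks of a combination of members \<open>h j\<close> because each of them may come with
  its own uniformizer.\<close>

lemma RR_space_zero_count:
  assumes G: "aut_subgroup G" and fin: "finite G"
    and Qinf: "is_place (fixed_field G) Qinf" "lies_over Pinf Qinf"
    and h: "\<And>j. j \<in> J \<Longrightarrow> h j \<in> RR_space (fixed_field G) Qinf m"
    and g: "g = (\<Sum>j\<in>J. const (c j) * h j)"
    and S: "finite S" "card S > m * card G"
    and SV: "\<And>V. V \<in> S \<Longrightarrow> is_place UNIV V \<and> V \<inter> fixed_field G \<noteq> Qinf \<and> g \<in> maxideal V"
  shows "g = 0"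
proof -
  let ?F = "fixed_field G"
  have Qc: "Qinf = Pinf \<inter> ?F" by (rule lies_over_Pinf[OF G fin Qinf])
  obtain C D where D: "D \<noteq> 0" "degree C \<le> card G" "degree D \<le> card G"
    and w: "to_fract C / to_fract D \<in> ?F" "to_fract C / to_fract D \<notin> Pinf"
    using fixed_field_pole[OF G fin] by metis
  define w where "w = to_fract C / to_fract D"
  have w': "inverse w \<in> maxideal Qinf"
    using place_inverse[OF Qinf(1), of w] w Qc unfolding w_def by blast
  have "w \<noteq> 0" using w(2) place_0[OF is_place_Pinf] unfolding w_def by auto
  have hreg: "h j \<in> V" if "j \<in> J" "is_place UNIV V" "V \<inter> ?F \<noteq> Qinf" for j V
    using h[OF that(1)] is_place_contraction[OF G fin that(2)] that(3) by (auto simp: RR_space_def)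
  \<comment> \<open>\<open>inverse w\<close> vanishes at \<open>Qinf\<close>, so it is a multiple of
    every uniformizer there and can replace them all.\<close>
  have hinf: "h j * inverse w ^ m \<in> Qinf" if j: "j \<in> J" for j
  proof -
    obtain u where u: "uniformizer Qinf u" "u ^ m * h j \<in> Qinf"
      using h[OF j] by (auto simp: RR_space_def)
    then obtain v where v: "inverse w = u * v" "v \<in> Qinf" using w' by (auto simp: uniformizer_def)
    have "v ^ m * (u ^ m * h j) \<in> Qinf"
      using place_mult[OF Qinf(1)] place_power[OF Qinf(1)] u v by blast
    then show ?thesis by (simp add: v power_mult_distrib mult_ac)
  qed
  have greg: "g \<in> V" if V: "is_place UNIV V" and "V \<inter> ?F \<noteq> Qinf" for V
    unfolding g by (intro place_sum[OF V] place_mult[OF V] place_const[OF V] hreg that)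
  have "(\<Sum>j\<in>J. const (c j) * (h j * inverse w ^ m)) \<in> Qinf"
    by (intro place_sum[OF Qinf(1)] place_mult[OF Qinf(1)] place_const[OF Qinf(1)] hinf)
  then have ginf: "g * inverse w ^ m \<in> Qinf"
    by (simp add: g sum_distrib_right mult.assoc)
  \<comment> \<open>The left side is regular at finite places not above \<open>Qinf\<close>, the
    right side at finite places above \<open>Qinf\<close>.\<close>
  have gD: "g * to_fract (D ^ m) = g * inverse w ^ m * to_fract (C ^ m)"
  proof -
    have "to_fract C = w * to_fract D" using D by (simp add: w_def)
    then show ?thesis using \<open>w \<noteq> 0\<close> by (simp add: to_fract_power power_mult_distrib power_inverse)
  qed
  have "g * to_fract (D ^ m) \<in> V" if V: "is_place UNIV V" and x: "xvar \<in> V" for V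
  proof (cases "V \<inter> ?F = Qinf")
    case True
    then have "g * inverse w ^ m \<in> V" using ginf by blast
    then show ?thesis unfolding gD by (rule place_mult[OF V _ place_to_fract[OF V x]])
  next
    case False
    show ?thesis by (intro place_mult[OF V] place_to_fract[OF V x] greg[OF V False])
  qed
  then obtain A where A: "g * to_fract (D ^ m) = to_fract A"
    using finite_places_imp_poly[of "g * to_fract (D ^ m)"] by blast
  \<comment> \<open>Comparison with \<open>x ^ n\<close> at infinity turns regularity of
    \<open>g / w ^ m\<close> into a degree bound on \<open>A\<close>.\<close>
  define n where "n = m * card G"
  define M where "M = (monom 1 n :: 'a poly)"
  have M: "M \<noteq> 0" "degree M = n" by (simp_all add: M_def degree_monom_eq)
  have "degree (C ^ m) \<le> n"
    using order_trans[OF degree_power_le[of C m]] mult_le_mono1[OF D(2), of m]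
    by (simp add: n_def mult.commute)
  then have "to_fract (C ^ m) / to_fract M \<in> Pinf" by (simp only: Pinf_iff[OF M(1)] M(2))
  then have "g * inverse w ^ m * (to_fract (C ^ m) / to_fract M) \<in> Pinf"
    using place_mult[OF is_place_Pinf] ginf Qc by blast
  then have "to_fract A / to_fract M \<in> Pinf" by (simp flip: A add: gD)
  then have degA: "degree A \<le> n" by (simp only: Pinf_iff[OF M(1)] M(2))
  have "A = 0"
  proof (rule ccontr)
    assume "A \<noteq> 0"
    have x: "xvar \<in> V" if "V \<in> S" for V
      using SV[OF that] place_xvar_iff[of V] Qc by blast
    have "to_fract A \<in> maxideal V" if "V \<in> S" for V
      unfolding A[symmetric]
      using maxideal_mult_right[of UNIV V g] place_to_fract[of V] SV[OF that] x[OF that] by blast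
    then have "card S \<le> degree A"
      using card_zeros_le_degree[OF S(1) _ _ \<open>A \<noteq> 0\<close>] SV x by blast
    then show False using S degA by (simp add: n_def)
  qed
  then show ?thesis using A D by simp
qed

section \<open>Rational places that split completely\<close>

lemma rational_place_contraction:
  assumes G: "aut_subgroup G" "finite G" and Q: "rational_place (fixed_field G) Q"
    and V: "is_place UNIV V" and over: "lies_over V Q"
  shows "Q = V \<inter> fixed_field G"
proof -
  have Qp: "is_place (fixed_field G) Q" using Q by (simp add: rational_place_def)
  have sub: "maxideal Q \<subseteq> maxideal V" using over by (simp add: lies_over_def)
  have "f \<in> V" if "f \<in> Q" for f
  proof -
    \<comment> \<open>Rationality writes \<open>f\<close> as a constant plus a member of the maximal
      ideal of \<open>Q\<close>, and both parts lie in \<open>V\<close>.\<close>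
    obtain c where "f - const c \<in> maxideal Q" using Q \<open>f \<in> Q\<close> by (auto simp: rational_place_def)
    then show ?thesis using value_in_place[OF V] sub by blast
  qed
  moreover have "f \<in> Q" if f: "f \<in> V" "f \<in> fixed_field G" for f
  proof (rule ccontr)
    assume n: "f \<notin> Q"
    then have "f \<noteq> 0" using place_0[OF Qp] by auto
    moreover have "inverse f \<in> maxideal V" using place_inverse[OF Qp f(2) n] sub by blast
    ultimately show False using f by (simp add: maxideal_def)
  qed
  ultimately show ?thesis using place_subset[OF Qp] by blast
qed

text \<open>The orbit polynomial of \<open>x\<close> reduces at \<open>Q\<close> to a polynomial of degree \<open>card G\<close> over the
  constants that vanishes at all \<open>card G\<close> places above \<open>Q\<close>, so each of them has degree one.\<close>

lemma split_place_xvar_value: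
  assumes G: "aut_subgroup G" and fin: "finite G"
    and Q: "rational_place (fixed_field G) Q" "Q \<noteq> Pinf \<inter> fixed_field G"
    and card: "card {V. is_place UNIV V \<and> lies_over V Q} = card G"
    and V: "is_place UNIV V" "lies_over V Q"
  shows "\<exists>c. xvar - const c \<in> maxideal V"
proof -
  let ?F = "fixed_field G"
  define S where "S = {V. is_place UNIV V \<and> lies_over V Q}"
  have finS: "finite S"
    using card group_card_pos[OF G fin] unfolding S_def by (metis card.infinite less_irrefl)
  have Sp: "is_place UNIV W" "W \<inter> ?F = Q" if "W \<in> S" for W
    using that rational_place_contraction[OF G fin Q(1)] by (auto simp: S_def)
  have orb: "\<sigma> xvar \<in> W" if "W \<in> S" "\<sigma> \<in> G" for W \<sigma>
  proof -
    \<comment> \<open>The preimage has the same contraction \<open>Q\<close>, which differs from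
      that of \<open>Pinf\<close>. Hence no conjugate of \<open>xvar\<close> has a pole at
      \<open>W\<close>.\<close>
    have "\<sigma> -` W \<noteq> Pinf"
      using vimage_contraction[OF G fin that(2), of W] Sp[OF that(1)] Q(2) by metis
    then show ?thesis
      using place_xvar_iff[OF is_place_vimage[OF group_aut[OF G fin that(2)] Sp(1)[OF that(1)]]]
      by simp
  qed
  have xS: "xvar \<in> W" if "W \<in> S" for W
    using orb[OF that, of id] G by (simp add: aut_subgroup_def)
  have VS: "V \<in> S" using V by (simp add: S_def)
  define n where "n = card G"
  define c where "c = coeff (orbit_poly G xvar)"
  have "c k \<in> Q" for k
    using coeff_prod_linear_in_place[OF Sp(1)[OF VS], of G "\<lambda>\<sigma>. \<sigma> xvar" k] orb[OF VS]
      coeff_orbit_poly_fixed[OF G fin, of xvar k] Sp(2)[OF VS]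
    unfolding c_def by (auto simp: orbit_poly_def)
  then have "\<forall>k. \<exists>d. c k - const d \<in> maxideal Q" using Q(1) by (auto simp: rational_place_def)
  then obtain d where d: "\<And>k. c k - const (d k) \<in> maxideal Q" by metis
  \<comment> \<open>The orbit polynomial of \<open>xvar\<close> with its coefficients replaced by
    their residues at \<open>Q\<close>, read as a polynomial over the constants.\<close>
  define \<chi> where "\<chi> = monom 1 n + (\<Sum>k<n. monom (d k) k)"
  have mon: "to_fract (monom e k) = const e * xvar ^ k" for e k
    by (simp add: const_to_fract xvar_to_fract monom_altdef flip: to_fract_mult to_fract_power)
  have "to_fract \<chi> \<in> maxideal W" if W: "W \<in> S" for W
  proof -
    have Wp: "is_place UNIV W" by (rule Sp(1)[OF W])
    have "to_fract \<chi> = xvar ^ n + (\<Sum>k<n. const (d k) * xvar ^ k)"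
      by (simp add: \<chi>_def mon)
    also have "\<dots> = (\<Sum>k<n. const (d k) * xvar ^ k) - (\<Sum>k<n. c k * xvar ^ k)"
      using orbit_poly_root[OF G fin, of xvar] by (simp add: n_def c_def add_eq_0_iff2)
    also have "\<dots> = - (\<Sum>k<n. (c k - const (d k)) * xvar ^ k)"
      by (simp add: left_diff_distrib sum_subtractf)
    also have "\<dots> \<in> maxideal W"
      using d W by (intro maxideal_uminus[OF Wp] maxideal_sum[OF Wp] maxideal_mult_right[OF Wp]
          place_power[OF Wp xS[OF W]]) (auto simp: S_def lies_over_def)
    finally show ?thesis .
  qed
  have lt: "degree (\<Sum>k<n. monom (d k) k) < n"
    using group_card_pos[OF G fin]
    by (intro degree_sum_less) (auto simp: n_def intro: le_less_trans[OF degree_monom_le])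
  then have "degree \<chi> = n" by (simp add: \<chi>_def degree_add_eq_left degree_monom_eq)
  moreover have "\<chi> \<noteq> 0" using calculation group_card_pos[OF G fin] by (auto simp: n_def)
  moreover have "\<forall>W\<in>S. \<exists>p. place_poly W p" using place_poly_exists Sp xS by blast
  then obtain p where p: "\<And>W. W \<in> S \<Longrightarrow> place_poly W (p W)" by metis
  ultimately have le: "(\<Sum>W\<in>S. degree (p W)) \<le> n"
    using degree_prod_place_poly[OF finS, of p \<chi>] Sp xS \<open>\<And>W. W \<in> S \<Longrightarrow> to_fract \<chi> \<in> maxideal W\<close>
    by simp
  have ge: "degree (p W) \<ge> 1" if "W \<in> S" for W
    by (rule place_poly_degree[OF Sp(1)[OF that] xS[OF that] p[OF that]])
  \<comment> \<open>There are \<open>n\<close> places, each with a prime of degree at least one, and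
    the total degree is at most \<open>n\<close>.\<close>
  have "degree (p V) \<le> 1"
  proof -
    have "(\<Sum>W\<in>S. degree (p W)) = degree (p V) + (\<Sum>W\<in>S - {V}. degree (p W))"
      by (rule sum.remove[OF finS VS])
    moreover have "(\<Sum>W\<in>S - {V}. degree (p W)) \<ge> (\<Sum>W\<in>S - {V}. 1)"
      using ge by (intro sum_mono) auto
    moreover have "card (S - {V}) = n - 1"
      using finS VS card by (simp add: S_def n_def)
    ultimately show ?thesis using le group_card_pos[OF G fin] by (simp add: n_def)
  qed
  moreover have "p V \<noteq> 0" using p[OF VS] by (simp add: place_poly_def)
  \<comment> \<open>Modulo a prime of degree one, the variable reduces to a constant, which is the
    value of \<open>xvar\<close> at \<open>V\<close>.\<close>
  ultimately have "degree ([:0, 1:] mod p V) = 0"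
    using degree_mod_less[of "p V" "[:0, 1:]"] ge[OF VS] by auto
  then obtain e where "[:0, 1:] mod p V = [:e:]" using degree_eq_zeroE by blast
  then have "p V dvd [:0, 1:] - [:e:]" by (metis dvd_minus_mod)
  then have "to_fract ([:0, 1:] - [:e:]) \<in> maxideal V"
    using p[OF VS] unfolding place_poly_def by blast
  then show ?thesis by (metis const_to_fract xvar_to_fract to_fract_diff)
qed

text \<open>Having no finite pole makes \<open>z\<close> a polynomial, and pole order exactly one at
  infinity makes its degree exactly one.\<close>

lemma pole_divisor_Pinf_linear:
  assumes "pole_divisor_is UNIV Pinf z"
  shows "\<exists>a b. a \<noteq> 0 \<and> z = const b + const a * xvar"
proof -
  obtain h where h: "z = to_fract h"
    using assms finite_places_imp_poly[of z] xvar_notin_Pinf unfolding pole_divisor_is_def by blast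
  obtain u where u: "uniformizer Pinf u" "u * z \<in> Pinf" "u * z \<notin> maxideal Pinf"
    using assms by (auto simp: pole_divisor_is_def)
  obtain v where v: "inverse xvar = u * v" "v \<in> Pinf"
    using u(1) inverse_xvar_maxideal_Pinf by (auto simp: uniformizer_def)
  have "u * z * v \<in> Pinf" using place_mult[OF is_place_Pinf] u v by blast
  then have "to_fract h / xvar \<in> Pinf" by (simp add: divide_inverse v h mult_ac)
  then have "degree h \<le> 1" by (simp only: degree_le_1_iff_Pinf)
  obtain b h' where h': "h = pCons b h'" by (cases h)
  then have "degree h' = 0" using \<open>degree h \<le> 1\<close> by (cases "h' = 0") auto
  then obtain a where hab: "h = [:b, a:]" using h' degree_eq_zeroE by metis
  have z: "z = const b + const a * xvar" by (simp add: h hab to_fract_pCons)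
  \<comment> \<open>For constant \<open>z\<close> the product \<open>u * z\<close> would vanish at
    infinity, against the exact pole order.\<close>
  have "a \<noteq> 0"
  proof
    assume "a = 0"
    then have "z \<in> Pinf" using z place_const[OF is_place_Pinf] by simp
    moreover have "u \<in> maxideal Pinf"
      using u(1) place_1[OF is_place_Pinf] by (force simp: uniformizer_def)
    ultimately show False using u(3) maxideal_mult_right[OF is_place_Pinf] by blast
  qed
  then show ?thesis using z by blast
qed

section \<open>The code as an array of doubly extended Reed--Solomon blocks\<close>

lemma vector_space_fscale: "vector_space (fscale :: 'a::field \<Rightarrow> _)"
  by unfold_locales (auto simp: fscale_def fun_eq_iff algebra_simps)

lemma sum_fun_apply: "(\<Sum>i\<in>A. f i) k = (\<Sum>i\<in>A. f i k)"
  by (induction A rule: infinite_finite_induct) auto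

context vector_space
begin

text \<open>Passes from families to sets of vectors. Injectivity of \<open>b\<close> comes first: a
  coincidence would be a relation with coefficients 1 and -1.\<close>

lemma independent_family_dim:
  assumes fin: "finite I"
    and ind: "\<And>c. (\<Sum>i\<in>I. c i *s b i) = 0 \<Longrightarrow> \<forall>i\<in>I. c i = 0"
  shows "span (b ` I) = {\<Sum>i\<in>I. c i *s b i | c. True}" and "dim {\<Sum>i\<in>I. c i *s b i | c. True} = card I"
proof -
  have inj: "inj_on b I"
  proof (rule inj_onI, rule ccontr)
    fix i j assume ij: "i \<in> I" "j \<in> I" "b i = b j" "i \<noteq> j"
    define c where "c k = (if k = i then 1 else 0) - (if k = j then 1 else (0 :: 'a))" for k
    have "(\<Sum>k\<in>I. c k *s b k) = (\<Sum>k\<in>I. if k = i then b k else 0) - (\<Sum>k\<in>I. if k = j then b k else 0)"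
      unfolding sum_subtractf[symmetric] by (intro sum.cong) (auto simp: c_def scale_left_diff_distrib)
    also have "\<dots> = 0" using ij fin by (simp add: sum.delta)
    finally have "c i = 0" using ind ij by blast
    then show False using ij by (simp add: c_def)
  qed
  have sp: "(\<Sum>v\<in>b ` I. u v *s v) = (\<Sum>i\<in>I. u (b i) *s b i)" for u
    using inj by (simp add: sum.reindex)
  have "independent (b ` I)"
  proof
    assume "dependent (b ` I)"
    then obtain u where "\<exists>i\<in>I. u (b i) \<noteq> 0" "(\<Sum>i\<in>I. u (b i) *s b i) = 0"
      unfolding dependent_finite[OF finite_imageI[OF fin]] sp by blast
    then show False using ind[of "\<lambda>i. u (b i)"] by blast
  qed
  moreover show eq: "span (b ` I) = {\<Sum>i\<in>I. c i *s b i | c. True}"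
  proof -
    have "\<exists>u. (\<Sum>i\<in>I. c i *s b i) = (\<Sum>i\<in>I. u (b i) *s b i)" for c
      using inj by (intro exI[of _ "\<lambda>v. c (the_inv_into I b v)"] sum.cong) (auto simp: the_inv_into_f_f)
    then show ?thesis unfolding span_finite[OF finite_imageI[OF fin]] sp by auto
  qed
  ultimately show "dim {\<Sum>i\<in>I. c i *s b i | c. True} = card I"
    using dim_span_eq_card_independent[of "b ` I"] card_image[OF inj] by simp
qed

end

section \<open>Blocks, locality and injectivity of the encoding\<close>

context
  fixes r s t :: nat and v :: "nat \<Rightarrow> nat \<Rightarrow> 'a::{finite,field}" and \<zeta> :: "nat \<Rightarrow> nat \<Rightarrow> 'a"
  assumes r: "r \<ge> 1" and s: "s \<ge> 1"
    and \<zeta>_inj: "\<And>i. i \<in> {1..s} \<Longrightarrow> inj_on (\<zeta> i) {1..r+1}"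
    and v_inj: "\<And>c. (\<And>i. i \<in> {1..s} \<Longrightarrow> (\<Sum>j=1..t. c j * v i j) = 0) \<Longrightarrow> \<forall>j\<in>{1..t}. c j = 0"
begin

text \<open>Here \<open>v i j\<close> stands for \<open>f\<^sub>j(Q\<^sub>i)\<close> and \<open>\<zeta> i h\<close> for \<open>z(P\<^sub>i\<^sub>h)\<close>, with \<open>i\<close> and \<open>h\<close> counted from 1;
  the index \<open>i\<close> in \<open>block_poly\<close> and \<open>block\<close> below is counted from 0.\<close>

definition word :: "(nat \<Rightarrow> nat \<Rightarrow> 'a) \<Rightarrow> nat \<Rightarrow> 'a" where
  "word a k = (if k < s * (r + 1) then
       \<Sum>e<r. (\<Sum>j=1..t. a e j * v (k div (r + 1) + 1) j) * \<zeta> (k div (r + 1) + 1) (k mod (r + 1) + 1) ^ e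
     else if k < s * (r + 2) then \<Sum>j=1..t. a (r - 1) j * v (k - s * (r + 1) + 1) j
     else 0)"

definition block_poly :: "(nat \<Rightarrow> nat \<Rightarrow> 'a) \<Rightarrow> nat \<Rightarrow> 'a poly" where
  "block_poly a i = (\<Sum>e<r. monom (\<Sum>j=1..t. a e j * v (i + 1) j) e)"

definition block :: "nat \<Rightarrow> nat set" where
  "block i = (\<lambda>h. i * (r + 1) + h) ` {..r} \<union> {s * (r + 1) + i}"

lemma coeff_block_poly:
  "coeff (block_poly a i) e = (if e < r then \<Sum>j=1..t. a e j * v (i + 1) j else 0)"
  by (simp add: block_poly_def coeff_sum if_distrib[of "\<lambda>x. x = _"] cong: if_cong)

lemma degree_block_poly: "degree (block_poly a i) \<le> r - 1"
  using r by (intro degree_le) (auto simp: coeff_block_poly)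

lemma block_index_less:
  assumes "i < s" "h \<le> r"
  shows "i * (r + 1) + h < s * (r + 1)"
proof -
  have "i * (r + 1) + h < (i + 1) * (r + 1)" using assms by simp
  also have "\<dots> \<le> s * (r + 1)" using assms by (intro mult_le_mono1) simp
  finally show ?thesis .
qed

lemma word_block:
  assumes "i < s" "h \<le> r"
  shows "word a (i * (r + 1) + h) = poly (block_poly a i) (\<zeta> (i + 1) (h + 1))"
proof -
  have "(i * (r + 1) + h) div (r + 1) = i" "(i * (r + 1) + h) mod (r + 1) = h"
    using assms by (simp_all add: div_mult_self3 del: mult_Suc_right)
  then show ?thesis
    using block_index_less[OF assms]
    by (simp add: word_def block_poly_def poly_sum poly_monom del: mult_Suc_right)
qed

lemma word_extension:
  assumes "i < s"
  shows "word a (s * (r + 1) + i) = coeff (block_poly a i) (r - 1)"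
  using assms r by (simp add: word_def coeff_block_poly)

lemma finite_block: "finite (block i)"
  by (simp add: block_def)

lemma card_block: "card (block i) \<le> r + 2"
proof -
  have "card ((\<lambda>h. i * (r + 1) + h) ` {..r}) \<le> r + 1"
    using card_image_le[of "{..r}" "\<lambda>h. i * (r + 1) + h"] by simp
  then show ?thesis
    unfolding block_def using card_Un_le[of "(\<lambda>h. i * (r + 1) + h) ` {..r}" "{s * (r + 1) + i}"]
    by simp
qed

lemma block_subset: "i < s \<Longrightarrow> block i \<subseteq> {..<s * (r + 2)}"
  using block_index_less[of i] by (fastforce simp: block_def)

lemma in_some_block:
  assumes "k < s * (r + 2)"
  shows "\<exists>i<s. k \<in> block i"
proof (cases "k < s * (r + 1)")
  case True
  then have "k div (r + 1) < s" by (simp add: less_mult_imp_div_less)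
  moreover have "k = k div (r + 1) * (r + 1) + k mod (r + 1)" by (rule div_mult_mod_eq[symmetric])
  moreover have "k mod (r + 1) \<le> r" using mod_less_divisor[of "r + 1" k] by simp
  ultimately show ?thesis unfolding block_def by blast
next
  case False
  then have "k = s * (r + 1) + (k - s * (r + 1))" "k - s * (r + 1) < s" using assms by auto
  then show ?thesis unfolding block_def by blast
qed

text \<open>A nonzero polynomial of degree \<open>d\<close> at most \<open>r - 1\<close> vanishes at
  no more than \<open>d\<close> of the \<open>r + 1\<close> points. At least three nonzero values
  remain unless \<open>d = r - 1\<close>; then at least two remain, and the extension coordinate,
  now the leading coefficient, is a third.\<close>

lemma block_weight:
  assumes i: "i < s" and nz: "block_poly a i \<noteq> 0"
  shows "3 \<le> card {k \<in> block i. word a k \<noteq> 0}"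
proof -
  let ?p = "block_poly a i"
  define N where "N = {h. h \<le> r \<and> poly ?p (\<zeta> (i + 1) (h + 1)) \<noteq> 0}"
  define Z where "Z = {h. h \<le> r \<and> poly ?p (\<zeta> (i + 1) (h + 1)) = 0}"
  define M where "M = (if coeff ?p (r - 1) = 0 then {} else {s * (r + 1) + i})"
  have "card Z \<le> degree ?p"
  proof -
    have "inj_on (\<lambda>h. \<zeta> (i + 1) (h + 1)) Z"
      using i inj_onD[OF \<zeta>_inj[of "i + 1"]] by (fastforce simp: inj_on_def Z_def)
    then have "card Z = card ((\<lambda>h. \<zeta> (i + 1) (h + 1)) ` Z)" by (simp add: card_image)
    also have "\<dots> \<le> card {x. poly ?p x = 0}"
      using poly_roots_finite[OF nz] by (intro card_mono) (auto simp: Z_def)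
    finally show ?thesis using card_poly_roots_bound[OF nz] by simp
  qed
  moreover have "card N + card Z = r + 1"
  proof -
    have "N \<union> Z = {..r}" "N \<inter> Z = {}" "finite N" "finite Z" by (auto simp: N_def Z_def)
    then show ?thesis using card_Un_disjoint[of N Z] by simp
  qed
  \<comment> \<open>A vanishing extension coordinate loses one position, but it also lowers the
    bound on the degree by one.\<close>
  moreover have "card M + r \<ge> degree ?p + 2"
  proof (cases "coeff ?p (r - 1) = 0")
    case True
    then have "degree ?p \<noteq> r - 1" using nz by (metis leading_coeff_0_iff)
    then show ?thesis using degree_block_poly[of a i] by simp
  next
    case False
    then show ?thesis using degree_block_poly[of a i] r by (simp add: M_def)
  qed
  ultimately have "3 \<le> card N + card M" by simp
  also have "card N = card ((\<lambda>h. i * (r + 1) + h) ` N)" by (simp add: card_image)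
  also have "\<dots> + card M = card ((\<lambda>h. i * (r + 1) + h) ` N \<union> M)"
  proof (intro card_Un_disjoint[symmetric])
    show "(\<lambda>h. i * (r + 1) + h) ` N \<inter> M = {}"
      using block_index_less[OF i] by (force simp: N_def M_def simp del: mult_Suc_right)
  qed (auto simp: N_def M_def)
  also have "\<dots> \<le> card {k \<in> block i. word a k \<noteq> 0}"
  proof (intro card_mono subsetI)
    fix k assume "k \<in> (\<lambda>h. i * (r + 1) + h) ` N \<union> M"
    then show "k \<in> {k \<in> block i. word a k \<noteq> 0}"
    proof
      assume "k \<in> (\<lambda>h. i * (r + 1) + h) ` N"
      then show ?thesis using word_block[OF i] by (auto simp: N_def block_def)
    next
      assume "k \<in> M"
      then show ?thesis using word_extension[OF i] by (auto simp: M_def block_def split: if_splits)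
    qed
  qed (simp add: finite_block)
  finally show ?thesis .
qed

lemma word_eq_0_on_block:
  assumes "i < s" "block_poly a i = 0" "k \<in> block i"
  shows "word a k = 0"
  using assms word_block[of i] word_extension[of i] by (auto simp: block_def)

lemma word_beyond: "k \<ge> s * (r + 2) \<Longrightarrow> word a k = 0"
  by (auto simp: word_def)

text \<open>By \<open>block_weight\<close> a zero word has only zero block polynomials. So each row
  \<open>a e\<close> is evaluated to zero at every \<open>i\<close>, and \<open>v_inj\<close>
  applies.\<close>

lemma word_eq_0_imp:
  assumes "\<And>k. word a k = 0" "e < r" "j \<in> {1..t}"
  shows "a e j = 0"
proof -
  have "(\<Sum>j=1..t. a e j * v i j) = 0" if i: "i \<in> {1..s}" for i
  proof -
    obtain m where m: "i = m + 1" using i by (metis atLeastAtMost_iff le_add_diff_inverse2)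
    have "block_poly a m = 0"
      using block_weight[of m a] assms(1) m i by fastforce
    then have "coeff (block_poly a m) e = 0" by simp
    then show ?thesis using \<open>e < r\<close> m by (simp only: coeff_block_poly if_True)
  qed
  from v_inj[of "a e", OF this] show ?thesis using assms by blast
qed

section \<open>Linearity and dimension of the code\<close>

definition unit_word :: "nat \<times> nat \<Rightarrow> nat \<Rightarrow> 'a" where
  "unit_word = (\<lambda>(e, j). word (\<lambda>e' j'. if e' = e \<and> j' = j then 1 else 0))"

lemma unit_word_simp:
  assumes "e < r" "j \<in> {1..t}"
  shows "unit_word (e, j) k = (if k < s * (r + 1) then
       v (k div (r + 1) + 1) j * \<zeta> (k div (r + 1) + 1) (k mod (r + 1) + 1) ^ e
     else if k < s * (r + 2) then (if e = r - 1 then v (k - s * (r + 1) + 1) j else 0) else 0)"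
proof -
  have *: "(\<Sum>j'=1..t. (if e' = e \<and> j' = j then 1 else 0) * f j') = (if e' = e then f j else 0)"
    for f :: "nat \<Rightarrow> 'a" and e'
    using assms by (cases "e' = e") (simp_all add: if_distrib[of "\<lambda>x. x * _"] sum.delta cong: if_cong)
  have "(\<Sum>e'<r. (if e' = e then x else 0) * g e') = x * g e" for x :: 'a and g
    using assms by (simp add: if_distrib[of "\<lambda>x. x * _"] sum.delta cong: if_cong)
  then show ?thesis unfolding unit_word_def word_def prod.case * by (auto simp del: mult_Suc_right)
qed

lemma word_expand:
  "word a = (\<Sum>x\<in>{..<r} \<times> {1..t}. fscale (a (fst x) (snd x)) (unit_word x))"
proof
  fix k
  have "(\<Sum>x\<in>{..<r} \<times> {1..t}. fscale (a (fst x) (snd x)) (unit_word x)) k =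
      (\<Sum>e<r. \<Sum>j=1..t. a e j * unit_word (e, j) k)"
    by (simp add: sum_fun_apply fscale_def sum.cartesian_product case_prod_unfold)
  also have "\<dots> = word a k"
  proof -
    consider "k < s * (r + 1)" | "\<not> k < s * (r + 1)" "k < s * (r + 2)" | "k \<ge> s * (r + 2)"
      by linarith
    then show ?thesis
    proof cases
      case 1
      then show ?thesis
        unfolding word_def by (simp add: unit_word_simp sum_distrib_right mult.assoc del: mult_Suc_right)
    next
      case 2
      have "(\<Sum>e<r. \<Sum>j=1..t. a e j * unit_word (e, j) k) =
          (\<Sum>e<r. if e = r - 1 then \<Sum>j=1..t. a e j * v (k - s * (r + 1) + 1) j else 0)"
        using 2 by (intro sum.cong refl) (auto simp: unit_word_simp simp del: mult_Suc_right)
      then show ?thesis using 2 r by (simp add: word_def sum.delta del: mult_Suc_right)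
    next
      case 3
      then show ?thesis by (auto simp: unit_word_simp word_beyond)
    qed
  qed
  finally show "word a k = (\<Sum>x\<in>{..<r} \<times> {1..t}. fscale (a (fst x) (snd x)) (unit_word x)) k" by simp
qed

lemma code_eq_combinations:
  "{word a | a. True} = {\<Sum>x\<in>{..<r} \<times> {1..t}. fscale (c x) (unit_word x) | c. True}"
proof -
  have *: "(\<Sum>x\<in>{..<r} \<times> {1..t}. fscale (c x) (unit_word x)) = word (\<lambda>e j. c (e, j))" for c
    by (simp add: word_expand)
  have "word a = word (\<lambda>e j. (case_prod a) (e, j))" for a by simp
  then show ?thesis unfolding * by blast
qed

lemma unit_words_independent:
  assumes "(\<Sum>x\<in>{..<r} \<times> {1..t}. fscale (c x) (unit_word x)) = 0"
  shows "\<forall>x\<in>{..<r} \<times> {1..t}. c x = 0"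
proof -
  have "word (\<lambda>e j. c (e, j)) = 0" using assms by (simp add: word_expand)
  then have "word (\<lambda>e j. c (e, j)) k = 0" for k by simp
  from word_eq_0_imp[OF this] show ?thesis by auto
qed

lemma code_dim_words: "code_dim {word a | a. True} = r * t"
  using vector_space.independent_family_dim(2)[OF vector_space_fscale, of "{..<r} \<times> {1..t}" unit_word]
    unit_words_independent
  unfolding code_dim_def code_eq_combinations by (simp add: card_cartesian_product)

lemma linear_code_words: "linear_code (s * (r + 2)) {word a | a. True}"
proof -
  interpret vs: vector_space "fscale :: 'a \<Rightarrow> _" by (rule vector_space_fscale)
  have "{word a | a. True} = vs.span (unit_word ` ({..<r} \<times> {1..t}))"
    using vs.independent_family_dim(1)[of "{..<r} \<times> {1..t}" unit_word] unit_words_independent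
    unfolding code_eq_combinations by simp
  then have "vs.subspace {word a | a. True}" by simp
  then show ?thesis using word_beyond by (auto simp: linear_code_def)
qed

text \<open>The blocks serve as recovery sets; the size bound \<open>r + 2\<close> is
  \<open>r + \<delta> - 1\<close> for \<open>\<delta> = 3\<close>.\<close>

lemma is_LRC_words: "is_LRC (s * (r + 2)) r 3 {word a | a. True}"
  unfolding is_LRC_def
proof (intro conjI allI impI linear_code_words)
  fix k assume "k < s * (r + 2)"
  then obtain i where i: "i < s" "k \<in> block i" using in_some_block by blast
  have "punct_dist_ge {word a | a. True} (block i) 3"
    unfolding punct_dist_ge_def
    using word_eq_0_on_block[OF i(1)] block_weight[OF i(1)] by blast
  then show "\<exists>I. k \<in> I \<and> I \<subseteq> {..<s * (r + 2)} \<and> card I \<le> r + 3 - 1 \<and>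
      punct_dist_ge {word a | a. True} I 3"
    using i block_subset card_block[of i] by (intro exI[of _ "block i"]) auto
qed

section \<open>Minimum distance\<close>

lemma finite_word_support: "finite {k. word a k \<noteq> 0}"
proof (rule finite_subset)
  show "{k. word a k \<noteq> 0} \<subseteq> {..<s * (r + 2)}" using word_beyond[of _ a] not_le by blast
qed simp

text \<open>A nonzero word is nonzero on some block, and that block alone contributes three
  positions.\<close>

lemma word_weight_ge:
  assumes "word a \<noteq> 0"
  shows "3 \<le> weight (word a)"
proof -
  obtain k where k: "word a k \<noteq> 0" using assms by (auto simp: fun_eq_iff)
  then have "k < s * (r + 2)" using word_beyond by (meson not_le)
  then obtain i where i: "i < s" "k \<in> block i" using in_some_block by blast
  then have "3 \<le> card {k \<in> block i. word a k \<noteq> 0}"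
    using block_weight word_eq_0_on_block k by blast
  also have "\<dots> \<le> weight (word a)"
    unfolding weight_def using finite_word_support by (intro card_mono) auto
  finally show ?thesis .
qed

text \<open>For \<open>t = s\<close> the injective evaluation map on \<open>L((t - 1) Q\<^sub>\<infinity>)\<close> is bijective, since the field is finite.\<close>

lemma interpolation:
  assumes ts: "t = s"
  shows "\<exists>c. \<forall>i\<in>{1..s}. (\<Sum>j=1..t. c j * v i j) = y i"
proof -
  \<comment> \<open>Extensional functions form a finite set and are determined by their values on
    \<open>{1..s}\<close>. For \<open>t = s\<close> the map has the same domain and
    codomain.\<close>
  let ?X = "{1..s} \<rightarrow>\<^sub>E (UNIV :: 'a set)"
  define T where "T c = restrict (\<lambda>i. \<Sum>j=1..t. c j * v i j) {1..s}" for c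
  have "inj_on T ?X"
  proof (rule inj_onI)
    fix c d assume c: "c \<in> ?X" and d: "d \<in> ?X" and eq: "T c = T d"
    have "(\<Sum>j=1..t. (c j - d j) * v i j) = 0" if "i \<in> {1..s}" for i
      using fun_cong[OF eq, of i] that by (simp add: T_def left_diff_distrib sum_subtractf)
    then have "\<forall>j\<in>{1..t}. c j - d j = 0" by (rule v_inj)
    then show "c = d" using c d ts by (intro PiE_ext[of c "{1..s}" _ d]) auto
  qed
  moreover have "T ` ?X \<subseteq> ?X" by (auto simp: T_def)
  moreover have "finite ?X" by (intro finite_PiE) auto
  ultimately have "T ` ?X = ?X" by (intro endo_inj_surj)
  then have "restrict y {1..s} \<in> T ` ?X" by auto
  then obtain c where c: "restrict y {1..s} = T c" by blast
  have "(\<Sum>j=1..t. c j * v i j) = y i" if "i \<in> {1..s}" for i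
    using fun_cong[OF c, of i] that by (simp add: T_def)
  then show ?thesis by blast
qed

text \<open>Interpolation puts a polynomial with \<open>r - 1\<close> roots among the points of the
  first block there, and zero into all other blocks. Only two point values and one extension
  coordinate remain.\<close>

lemma word_of_weight_3:
  assumes ts: "t = s"
  shows "\<exists>a. word a \<noteq> 0 \<and> weight (word a) = 3"
proof -
  \<comment> \<open>Monic of degree \<open>r - 1\<close>, so the extension coordinate is 1. For
    \<open>r = 1\<close> it is the empty product.\<close>
  define \<psi> where "\<psi> = (\<Prod>h=1..r-1. [:- \<zeta> 1 h, 1:])"
  have deg: "degree \<psi> = r - 1" by (simp add: \<psi>_def degree_prod_eq_sum_degree)
  have lead: "coeff \<psi> (r - 1) = 1" unfolding deg[symmetric] by (simp add: \<psi>_def lead_coeff_prod)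
  have "\<forall>e. \<exists>c. \<forall>i\<in>{1..s}. (\<Sum>j=1..t. c j * v i j) = (if i = 1 then coeff \<psi> e else 0)"
    using interpolation[OF ts, of "\<lambda>i. if i = 1 then coeff \<psi> _ else 0"] by (rule allI)
  then obtain a where a: "\<And>e i. i \<in> {1..s} \<Longrightarrow> (\<Sum>j=1..t. a e j * v i j) = (if i = 1 then coeff \<psi> e else 0)"
    by metis
  have p0: "block_poly a 0 = \<psi>"
    using s r a[of 1] deg by (intro poly_eqI) (auto simp: coeff_block_poly coeff_eq_0)
  have pi: "block_poly a i = 0" if "i < s" "i \<noteq> 0" for i
    using that a[of "i + 1"] by (intro poly_eqI) (auto simp: coeff_block_poly)
  have "word a (s * (r + 1) + 0) = 1" using word_extension[of 0] s p0 lead by simp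
  then have nz: "word a \<noteq> 0" by (intro notI) simp
  \<comment> \<open>The points \<open>h = r\<close> and \<open>h = r + 1\<close>, not chosen as
    roots, sit at positions \<open>r - 1\<close> and \<open>r\<close> counted from 0. Position
    \<open>s * (r + 1)\<close> is the extension coordinate of block 0.\<close>
  have "{k. word a k \<noteq> 0} \<subseteq> {r - 1, r, s * (r + 1)}"
  proof
    fix k assume k: "k \<in> {k. word a k \<noteq> 0}"
    then have "k < s * (r + 2)" using word_beyond[of k a] by (simp add: not_le[symmetric]) blast
    then obtain i where i: "i < s" "k \<in> block i" using in_some_block by blast
    then have i0: "i = 0" using pi word_eq_0_on_block k by blast
    show "k \<in> {r - 1, r, s * (r + 1)}"
    proof (cases "k = s * (r + 1)")
      case False
      then have kr: "k \<le> r" using i i0 by (auto simp: block_def)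
      then have "poly \<psi> (\<zeta> 1 (k + 1)) \<noteq> 0" using word_block[of 0 k a] i i0 k p0 by simp
      then have "k + 1 \<notin> {1..r-1}" by (auto simp: \<psi>_def poly_prod)
      then show ?thesis using kr by auto
    qed simp
  qed
  then have "weight (word a) \<le> card {r - 1, r, s * (r + 1)}"
    unfolding weight_def by (intro card_mono) auto
  also have "\<dots> \<le> 3" by (simp add: card_insert_if)
  finally show ?thesis using word_weight_ge[OF nz] nz by (intro exI[of _ a]) simp
qed

lemma min_dist_words:
  assumes "t = s"
  shows "min_dist {word a | a. True} = 3"
  unfolding min_dist_def
proof (rule Min_eqI)
  show "finite {weight c | c. c \<in> {word a | a. True} \<and> c \<noteq> 0}"
  proof (rule finite_subset)
    show "{weight c | c. c \<in> {word a | a. True} \<and> c \<noteq> 0} \<subseteq> {..s * (r + 2)}"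
    proof
      fix y assume "y \<in> {weight c | c. c \<in> {word a | a. True} \<and> c \<noteq> 0}"
      then obtain a where "y = weight (word a)" by blast
      moreover have "{k. word a k \<noteq> 0} \<subseteq> {..<s * (r + 2)}" using word_beyond[of _ a] not_le by blast
      ultimately show "y \<in> {..s * (r + 2)}"
        unfolding weight_def using card_mono[of "{..<s * (r + 2)}" "{k. word a k \<noteq> 0}"] by simp
    qed
  qed simp
  show "3 \<le> y" if "y \<in> {weight c | c. c \<in> {word a | a. True} \<and> c \<noteq> 0}" for y
    using that word_weight_ge by blast
  show "3 \<in> {weight c | c. c \<in> {word a | a. True} \<and> c \<noteq> 0}"
    using word_of_weight_3[OF assms] by force
qed

end

section \<open>The evaluation code as an array of blocks\<close>

theorem mainTheorem3:
  fixes G :: "('a::{finite,field} ratfun \<Rightarrow> 'a ratfun) set"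
    and p r s t :: nat
    and z :: "'a ratfun"
    and Qinf :: "'a ratfun set"
    and Q :: "nat \<Rightarrow> 'a ratfun set"
    and P :: "nat \<Rightarrow> nat \<Rightarrow> 'a ratfun set"
    and f :: "nat \<Rightarrow> 'a ratfun"
  defines "q \<equiv> card (UNIV :: 'a set)"
  defines "F \<equiv> fixed_field G"
  defines "fa \<equiv> (\<lambda>a::nat \<Rightarrow> nat \<Rightarrow> 'a. \<Sum>i<r. \<Sum>j=1..t. const (a i j) * f j * z ^ i)"
  defines "Ce \<equiv> {(\<lambda>k. if k < s * (r + 1) then eval_at (P (k div (r + 1) + 1) (k mod (r + 1) + 1)) (fa a)
                   else if k < s * (r + 2) then
                     eval_at (Q (k - s * (r + 1) + 1)) (\<Sum>j=1..t. const (a (r - 1) j) * f j)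
                   else 0) | a. True}"
  assumes p_prime: "prime p"
    and q_pow: "\<exists>m>0. q = p ^ m"
    and r_pos: "r \<ge> 1"
    and r_cond: "(\<exists>v. r = p ^ v - 1) \<or> (r + 1) dvd (q - 1) \<or> (\<exists>u v. u > 0 \<and> v > 0 \<and> r + 1 = u * p ^ v)"
    and G_sub: "aut_subgroup G"
    and G_fin: "finite G"
    and G_card: "card G = r + 1"
    and Qinf_place: "is_place F Qinf"
    and Qinf_under: "lies_over Pinf Qinf"
    and z_pole: "pole_divisor_is UNIV Pinf z"
    and s_lb: "2 \<le> s"
    and s_ub: "real s \<le> (real q + 1 - 2 * real r) / (real r + 1)"
    and Q_rat: "\<forall>i\<in>{1..s}. rational_place F (Q i)"
    and Q_inj: "inj_on Q {1..s}"
    and Q_ne_inf: "\<forall>i\<in>{1..s}. Q i \<noteq> Qinf"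
    and Q_split: "\<forall>i\<in>{1..s}. card {V'. is_place UNIV V' \<and> lies_over V' (Q i)} = r + 1"
    and P_enum: "\<forall>i\<in>{1..s}. P i ` {1..r+1} = {V'. is_place UNIV V' \<and> lies_over V' (Q i)}"
    and P_inj: "\<forall>i\<in>{1..s}. inj_on (P i) {1..r+1}"
    and t_bounds: "1 \<le> t" "t \<le> s"
    and f_in: "\<forall>j\<in>{1..t}. f j \<in> RR_space F Qinf (t - 1)"
    and f_span: "\<forall>g\<in>RR_space F Qinf (t - 1). \<exists>c. g = (\<Sum>j=1..t. const (c j) * f j)"
    and f_indep: "\<forall>c. (\<Sum>j=1..t. const (c j) * f j) = 0 \<longrightarrow> (\<forall>j\<in>{1..t}. c j = 0)"
  shows "is_LRC (s * (r + 2)) r 3 Ce \<and> code_dim Ce = r * t \<and>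
         (t = s \<longrightarrow> optimal_LRC (s * (r + 2)) r 3 Ce \<and>
             int (min_dist Ce) = int (s * (r + 2)) - int (r * t) - 2 * int t + 3)"
proof -
  note G = G_sub G_fin
  have Qinf: "Qinf = Pinf \<inter> F"
    unfolding F_def by (rule lies_over_Pinf[OF G Qinf_place[unfolded F_def] Qinf_under])
  obtain \<alpha> \<beta> where z: "\<alpha> \<noteq> 0" "z = const \<beta> + const \<alpha> * xvar"
    using pole_divisor_Pinf_linear[OF z_pole] by blast
  have PV: "is_place UNIV (P i h)" and Pover: "lies_over (P i h) (Q i)"
    if "i \<in> {1..s}" "h \<in> {1..r+1}" for i h
    using P_enum that by blast+
  have Qc: "Q i = P i h \<inter> F" if "i \<in> {1..s}" "h \<in> {1..r+1}" for i h
    unfolding F_def using rational_place_contraction[OF G _ PV Pover, of i h] Q_rat that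
    by (auto simp: F_def)
  have mQ: "maxideal (Q i) = maxideal (P i h) \<inter> F" if "i \<in> {1..s}" "h \<in> {1..r+1}" for i h
    unfolding Qc[OF that] unfolding F_def by (rule maxideal_contraction[OF G])
  have h1: "1 \<in> {1..r+1}" by simp
  have fF: "f j \<in> F" if "j \<in> {1..t}" for j using f_in that by (auto simp: RR_space_def)
  \<comment> \<open>Each \<open>f j\<close> has no pole except possibly at \<open>Qinf\<close>, so
    it is regular at \<open>Q i\<close>; the residues form the matrix \<open>v\<close>.\<close>
  have "\<exists>c. f j - const c \<in> maxideal (Q i)" if "i \<in> {1..s}" "j \<in> {1..t}" for i j
  proof -
    have "is_place F (Q i)" "Q i \<noteq> Qinf" using Q_rat Q_ne_inf that by (auto simp: rational_place_def)
    then have "f j \<in> Q i" using f_in that by (auto simp: RR_space_def)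
    then show ?thesis using Q_rat that by (auto simp: rational_place_def)
  qed
  then obtain v where v: "\<And>i j. i \<in> {1..s} \<Longrightarrow> j \<in> {1..t} \<Longrightarrow> f j - const (v i j) \<in> maxideal (Q i)"
    by metis
  have vP: "f j - const (v i j) \<in> maxideal (P i h)"
    if "i \<in> {1..s}" "h \<in> {1..r+1}" "j \<in> {1..t}" for i h j
    using v[OF that(1,3)] mQ[OF that(1,2)] by blast
  \<comment> \<open>\<open>z\<close> is linear in \<open>xvar\<close>, which has a value at
    \<open>P i h\<close> because \<open>Q i\<close> splits completely.\<close>
  have "\<exists>c. z - const c \<in> maxideal (P i h)" if ih: "i \<in> {1..s}" "h \<in> {1..r+1}" for i h
  proof -
    have "Q i \<noteq> Pinf \<inter> fixed_field G" using Q_ne_inf Qinf ih by (auto simp: F_def)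
    then obtain c where c: "xvar - const c \<in> maxideal (P i h)"
      using split_place_xvar_value[OF G _ _ _ PV[OF ih] Pover[OF ih]] Q_rat Q_split G_card ih
      by (auto simp: F_def)
    have "z - const (\<beta> + \<alpha> * c) = const \<alpha> * (xvar - const c)"
      by (simp add: z const_add const_mult right_diff_distrib)
    then show ?thesis using maxideal_mult_left[OF PV[OF ih] place_const[OF PV[OF ih]] c] by metis
  qed
  then obtain \<zeta> where \<zeta>: "\<And>i h. i \<in> {1..s} \<Longrightarrow> h \<in> {1..r+1} \<Longrightarrow> z - const (\<zeta> i h) \<in> maxideal (P i h)"
    by metis
  have xP: "xvar \<in> P i h" if "i \<in> {1..s}" "h \<in> {1..r+1}" for i h
    using Qc[OF that] Qinf Q_ne_inf that place_xvar_iff[OF PV[OF that]] by auto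
  have \<zeta>_inj: "inj_on (\<zeta> i) {1..r+1}" if i: "i \<in> {1..s}" for i
  proof (rule inj_onI, rule ccontr)
    fix h h' assume h: "h \<in> {1..r+1}" "h' \<in> {1..r+1}" and eq: "\<zeta> i h = \<zeta> i h'" and "h \<noteq> h'"
    then have ne: "P i h \<noteq> P i h'" using P_inj i inj_onD[of "P i" "{1..r+1}" h h'] by blast
    \<comment> \<open>This polynomial of degree one represents
      \<open>z - const (\<zeta> i h)\<close>; equal values at two places above \<open>Q i\<close>
      would give it two zeros.\<close>
    define A where "A = [:\<beta> - \<zeta> i h, \<alpha>:]"
    have A: "to_fract A = z - const (\<zeta> i h)"
      by (simp add: A_def z to_fract_pCons const_diff mult.commute)
    have "card {P i h, P i h'} \<le> degree A"
    proof (rule card_zeros_le_degree)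
      show "to_fract A \<in> maxideal V" if "V \<in> {P i h, P i h'}" for V
        using that \<zeta>[OF i h(1)] \<zeta>[OF i h(2)] eq A by auto
    qed (use PV xP i h z in \<open>auto simp: A_def\<close>)
    then show False using ne by (simp add: A_def split: if_splits)
  qed
  have comb: "(\<Sum>j=1..t. const (c j) * f j) - const (\<Sum>j=1..t. c j * v i j) \<in> maxideal (P i h)"
    if ih: "i \<in> {1..s}" "h \<in> {1..r+1}" for c i h
    using vP[OF ih] by (intro value_sum[OF PV[OF ih]] value_mult[OF PV[OF ih]] value_const[OF PV[OF ih]]
      place_const[OF PV[OF ih]]) auto
  have combF: "(\<Sum>j=1..t. const (c j) * f j) \<in> F" for c
    using fF unfolding F_def
    by (intro fixed_field_sum[OF G] fixed_field_mult[OF G] fixed_field_const[OF G]) auto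
  \<comment> \<open>A combination with value zero at all \<open>Q i\<close> vanishes at the
    \<open>s * (r + 1)\<close> places \<open>P i h\<close>, more than the at most
    \<open>(t - 1) * (r + 1)\<close> zeros of a nonzero one.\<close>
  have v_inj: "\<forall>j\<in>{1..t}. c j = 0"
    if c: "\<And>i. i \<in> {1..s} \<Longrightarrow> (\<Sum>j=1..t. c j * v i j) = 0" for c
  proof -
    define S where "S = (\<lambda>(i, h). P i h) ` ({1..s} \<times> {1..r+1})"
    have "inj_on (\<lambda>(i, h). P i h) ({1..s} \<times> {1..r+1})"
    proof (rule inj_onI, clarify)
      fix i h i' h' assume i: "i \<in> {1..s}" "i' \<in> {1..s}" "h \<in> {1..r+1}" "h' \<in> {1..r+1}"
        and eq: "P i h = P i' h'"
      \<comment> \<open>The place below recovers \<open>Q i\<close> and with it the index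
        \<open>i\<close>.\<close>
      then have "Q i = Q i'" using Qc[of i h] Qc[of i' h'] by simp
      then have "i = i'" using Q_inj i by (auto dest: inj_onD)
      then show "i = i' \<and> h = h'" using P_inj i eq inj_onD[of "P i" "{1..r+1}" h h'] by blast
    qed
    then have cS: "card S = s * (r + 1)"
      unfolding S_def by (subst card_image) (simp_all add: card_cartesian_product)
    have "(t - 1) * card G < card S"
      unfolding cS G_card using t_bounds s_lb by (intro mult_strict_right_mono) auto
    moreover have "is_place UNIV V \<and> V \<inter> fixed_field G \<noteq> Qinf \<and> (\<Sum>j=1..t. const (c j) * f j) \<in> maxideal V"
      if V: "V \<in> S" for V
    proof -
      obtain i h where ih: "i \<in> {1..s}" "h \<in> {1..r+1}" "V = P i h" using V by (auto simp: S_def)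
      have "V \<inter> fixed_field G \<noteq> Qinf"
        using Qc[OF ih(1,2)] ih Q_ne_inf unfolding F_def by metis
      moreover have "(\<Sum>j=1..t. const (c j) * f j) \<in> maxideal V"
        using comb[OF ih(1,2), of c] c[OF ih(1)] ih(3) by simp
      ultimately show ?thesis using PV ih by blast
    qed
    moreover have "finite S" by (simp add: S_def)
    ultimately have "(\<Sum>j=1..t. const (c j) * f j) = 0"
      using f_in by (intro RR_space_zero_count[OF G Qinf_place[unfolded F_def] Qinf_under,
            of "{1..t}" f "t - 1" _ c S]) (auto simp: F_def)
    then show ?thesis using f_indep by blast
  qed
  have evP: "eval_at (P i h) (fa a) = (\<Sum>e<r. (\<Sum>j=1..t. a e j * v i j) * \<zeta> i h ^ e)"
    if ih: "i \<in> {1..s}" "h \<in> {1..r+1}" for i h a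
  proof (rule eval_at_eqI[OF PV[OF ih]])
    note V = PV[OF ih]
    have eq: "fa a = (\<Sum>e<r. (\<Sum>j=1..t. const (a e j) * f j) * z ^ e)"
      by (simp add: fa_def sum_distrib_right)
    show "fa a - const (\<Sum>e<r. (\<Sum>j=1..t. a e j * v i j) * \<zeta> i h ^ e) \<in> maxideal (P i h)"
      unfolding eq
      by (intro value_sum[OF V] value_mult[OF V] value_power[OF V] comb[OF ih] \<zeta>[OF ih]
          value_in_place[OF V comb[OF ih]])
  qed
  \<comment> \<open>The residue at \<open>Q i\<close> is computed at a place above it; the first
    one, \<open>P i 1\<close>, serves.\<close>
  have evQ: "eval_at (Q i) (\<Sum>j=1..t. const (c j) * f j) = (\<Sum>j=1..t. c j * v i j)"
    if i: "i \<in> {1..s}" for i c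
    unfolding Qc[OF i h1] unfolding F_def
    by (rule eval_at_contraction[OF G PV[OF i h1] combF[unfolded F_def] comb[OF i h1]])
  have s1: "s \<ge> 1" using s_lb by simp
  \<comment> \<open>These four facts discharge the assumptions of the context in which
    \<open>word\<close> and its lemmas were set up.\<close>
  note code = r_pos s1 \<zeta>_inj v_inj
  have word: "(\<lambda>k. if k < s * (r + 1) then eval_at (P (k div (r + 1) + 1) (k mod (r + 1) + 1)) (fa a)
                   else if k < s * (r + 2) then
                     eval_at (Q (k - s * (r + 1) + 1)) (\<Sum>j=1..t. const (a (r - 1) j) * f j)
                   else 0) = word r s t v \<zeta> a" for a
  proof
    fix k
    have "k div (r + 1) + 1 \<in> {1..s}" if "k < s * (r + 1)"
      using that less_mult_imp_div_less[of k s "r + 1"] by simp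
    moreover have "k mod (r + 1) + 1 \<in> {1..r+1}"
      using mod_less_divisor[of "r + 1" k] by simp
    moreover have "k - s * (r + 1) + 1 \<in> {1..s}" if "\<not> k < s * (r + 1)" "k < s * (r + 2)"
      using that by auto
    ultimately show "(if k < s * (r + 1) then eval_at (P (k div (r + 1) + 1) (k mod (r + 1) + 1)) (fa a)
                   else if k < s * (r + 2) then
                     eval_at (Q (k - s * (r + 1) + 1)) (\<Sum>j=1..t. const (a (r - 1) j) * f j)
                   else 0) = word r s t v \<zeta> a k"
      using evP evQ[of _ "a (r - 1)"] by (simp only: word_def[OF code] split: if_split) blast
  qed
  have Ce: "Ce = {word r s t v \<zeta> a | a. True}" unfolding Ce_def word ..
  have lrc: "is_LRC (s * (r + 2)) r 3 Ce" unfolding Ce by (rule is_LRC_words[OF code])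
  have dim: "code_dim Ce = r * t" unfolding Ce by (rule code_dim_words[OF code])
  have md: "min_dist Ce = 3" if "t = s" unfolding Ce by (rule min_dist_words[OF code that])
  \<comment> \<open>As the dimension is \<open>r * t\<close>, the ceiling is \<open>t\<close>. For
    \<open>t = s\<close> the bound \<open>s * (r + 2) - r * t - 2 * t + 3\<close> then equals 3, the
    distance found.\<close>
  have "\<lceil>real (code_dim Ce) / real r\<rceil> = int t" using r_pos by (simp add: dim)
  then show ?thesis using lrc dim md r_pos
    by (simp add: optimal_LRC_def algebra_simps)
qed

end
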